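(* Let $n\ge 3$ and let $\mathrm{VTL}_n'$ be the algebra over $\mathbb{Z}[z]$ defined by the presentation with generators $E_1',\dots,E_{n-1}',v_1',\dots,v_{n-1}'$ and relations $$E_i'^2=zE_i',\quad v_i'^2=1,\quad E_i'v_i'=v_i'E_i'=E_i',\qquad\text{for }1\le i\le n-1,$$ $$E_i'E_j'=E_j'E_i',\quad v_i'v_j'=v_j'v_i',\quad v_i'E_j'=E_j'v_i',\qquad\text{for }|i-j|\ge 2,$$ $$E_i'E_j'E_i'=E_i',\quad v_i'v_j'v_i'=v_j'v_i'v_j',\quad v_i'v_j'E_i'=E_j'v_i'v_j',\qquad\text{for }|i-j|=1.$$ Let $\varphi:\mathrm{VTL}_n'\to\mathrm{VTL}_n$ be the ($\mathbb{Z}[z]$-algebra) homomorphism that sends $E_i'$ to $E_i$ and $v_i'$ to $v_i$ for all $i\in\{1,\dots,n-1\}$. Then $\varphi$ is surjective but not injective.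
   Context: Let $R_0^f=\mathbb{Z}[z]$. For $n\ge 1$, a flat virtual $n$-tangle is a partition of $V_n=\{0,1\}\times\{1,\dots,n\}$ into ($n$) pairs; $\mathcal{E}_n$ is the set of flat virtual $n$-tangles. $\mathrm{VTL}_n$ (the $n$-th virtual Temperley--Lieb algebra) is the free $R_0^f$-module with basis $\mathcal{E}_n$, with the following bilinear multiplication. For $E,E'\in\mathcal{E}_n$, view the pairs as edges (arcs) and concatenate: take disjoint copies of the two and glue the point $(1,i)$ of $E$ to the point $(0,i)$ of $E'$ for each $i$. The result consists of $n$ arcs, whose endpoints are the points $(0,i)$ of $E$ and the points $(1,i)$ of $E'$, and some number $m$ of closed curves. The $n$ arcs determine a flat virtual $n$-tangle $E*E'$, and $E\,E'=z^m(E*E')$. This is an associative algebra with unit $\{\{(0,k),(1,k)\}\mid 1\le k\le n\}$. For $1\le i\le n-1$: $E_i=\{\{(0,i),(0,i+1)\},\{(1,i),(1,i+1)\}\}\cup\{\{(0,k),(1,k)\}\mid k\ne i,i+1\}$ and $v_i=\{\{(0,i),(1,i+1)\},\{(0,i+1),(1,i)\}\}\cup\{\{(0,k),(1,k)\}\mid k\neq i,i+1\}$. *)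

theory Defs
  imports
    "HOL-Library.Poly_Mapping"
    "HOL-Library.Disjoint_Sets"
    "HOL-Computational_Algebra.Polynomial"
    "HOL-Algebra.Module"
    "HOL-Algebra.QuotRing"
begin

section \<open>Algebras over a commutative ring\<close>

text \<open>
  The locale \<^locale>\<open>algebra\<close> of the library is about commutative algebras. Here a unital
  associative algebra is a \<^typ>\<open>('r, 'a) module\<close> record, whose scalars are
  all elements of a type \<^typ>\<open>'r\<close> of class \<^class>\<open>comm_ring_1\<close>.
\<close>

definition alg_hom ::
    "('r, 'a, 'm) module_scheme \<Rightarrow> ('r, 'b, 'k) module_scheme \<Rightarrow> ('a \<Rightarrow> 'b) set" where
  "alg_hom A B =
     {h \<in> ring_hom A B. \<forall>c. \<forall>x \<in> carrier A. h (c \<odot>\<^bsub>A\<^esub> x) = c \<odot>\<^bsub>B\<^esub> h x}"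

definition scale :: "'r \<Rightarrow> ('b \<Rightarrow>\<^sub>0 'r) \<Rightarrow> ('b \<Rightarrow>\<^sub>0 'r::comm_ring_1)" where
  "scale c x = Poly_Mapping.map ((*) c) x"

text \<open>
  The free module with basis \<open>B\<close>, with the bilinear multiplication that is given on basis
  elements by \<open>\<mu>\<close>, and with the basis element \<open>e\<close> as unit.
\<close>

definition based_algebra ::
    "'b set \<Rightarrow> ('b \<Rightarrow> 'b \<Rightarrow> ('b \<Rightarrow>\<^sub>0 'r)) \<Rightarrow> 'b \<Rightarrow> ('r::comm_ring_1, 'b \<Rightarrow>\<^sub>0 'r) module" where
  "based_algebra B \<mu> e =
     \<lparr>carrier = {x. Poly_Mapping.keys x \<subseteq> B},
      mult = (\<lambda>x y. \<Sum>u\<in>Poly_Mapping.keys x. \<Sum>v\<in>Poly_Mapping.keys y.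
        scale (Poly_Mapping.lookup x u * Poly_Mapping.lookup y v) (\<mu> u v)),
      one = Poly_Mapping.single e 1,
      zero = 0,
      add = (+),
      smult = scale\<rparr>"

text \<open>The free associative algebra on \<open>X\<close>: its basis is the set of words over \<open>X\<close>.\<close>

abbreviation word :: "'g list \<Rightarrow> ('g list \<Rightarrow>\<^sub>0 'r::comm_ring_1)" where
  "word w \<equiv> Poly_Mapping.single w 1"

definition free_algebra :: "'g set \<Rightarrow> ('r::comm_ring_1, 'g list \<Rightarrow>\<^sub>0 'r) module" where
  "free_algebra X = based_algebra (lists X) (\<lambda>u v. word (u @ v)) []"

text \<open>
  The algebra presented by generators \<open>X\<close> and relations \<open>x = y\<close> for \<open>(x, y) \<in> S\<close>. Its elements
  are cosets; the scalar multiplication is defined in the style of \<^const>\<open>rcoset_mult\<close>.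
\<close>

definition relation_ideal ::
    "'g set \<Rightarrow> (('g list \<Rightarrow>\<^sub>0 'r) \<times> ('g list \<Rightarrow>\<^sub>0 'r)) set \<Rightarrow> ('g list \<Rightarrow>\<^sub>0 'r::comm_ring_1) set" where
  "relation_ideal X S = Idl\<^bsub>free_algebra X\<^esub> {x - y | x y. (x, y) \<in> S}"

definition presented_algebra ::
    "'g set \<Rightarrow> (('g list \<Rightarrow>\<^sub>0 'r) \<times> ('g list \<Rightarrow>\<^sub>0 'r)) set
       \<Rightarrow> ('r::comm_ring_1, ('g list \<Rightarrow>\<^sub>0 'r) set) module" where
  "presented_algebra X S =
     (let F = free_algebra X; I = relation_ideal X S; Q = F Quot I in
      \<lparr>carrier = carrier Q, mult = mult Q, one = one Q, zero = zero Q, add = add Q,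
       smult = (\<lambda>c C. \<Union>x\<in>C. I +>\<^bsub>F\<^esub> (c \<odot>\<^bsub>F\<^esub> x))\<rparr>)"

definition presented_gen ::
    "'g set \<Rightarrow> (('g list \<Rightarrow>\<^sub>0 'r) \<times> ('g list \<Rightarrow>\<^sub>0 'r)) set
       \<Rightarrow> 'g \<Rightarrow> ('g list \<Rightarrow>\<^sub>0 'r::comm_ring_1) set" where
  "presented_gen X S g = relation_ideal X S +>\<^bsub>free_algebra X\<^esub> word [g]"


section \<open>Flat virtual tangles\<close>

type_synonym tangle = "(nat \<times> nat) set set"

definition tangle_points :: "nat \<Rightarrow> (nat \<times> nat) set" where
  "tangle_points n = {0, 1} \<times> {1..n}"

definition flat_tangles :: "nat \<Rightarrow> tangle set" where
  "flat_tangles n = {E. partition_on (tangle_points n) E \<and> (\<forall>p\<in>E. card p = 2)}"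

text \<open>
  Gluing \<open>E\<close> and \<open>E'\<close>: the points \<open>(0, i)\<close> and \<open>(1, i)\<close> of \<open>E\<close> keep their names, the points
  \<open>(0, i)\<close> and \<open>(1, i)\<close> of \<open>E'\<close> become \<open>(1, i)\<close> and \<open>(2, i)\<close>. The arcs and the closed curves of the
  result are the connected components, represented by the sets of points on them. (A pair that
  belongs to both \<open>E\<close> and the shifted \<open>E'\<close> is a component on its own, namely a closed curve made
  of two edges.)
\<close>

definition glued_edges :: "tangle \<Rightarrow> tangle \<Rightarrow> tangle" where
  "glued_edges E E' = E \<union> (\<lambda>p. apfst Suc ` p) ` E'"

definition glued_components :: "tangle \<Rightarrow> tangle \<Rightarrow> (nat \<times> nat) set set" where
  "glued_components E E' =
     \<Union>(glued_edges E E') // {(x, y). \<exists>p\<in>glued_edges E E'. x \<in> p \<and> y \<in> p}\<^sup>+"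

text \<open>The endpoints of a component, named as points of the concatenated tangle.\<close>

definition endpoints :: "(nat \<times> nat) set \<Rightarrow> (nat \<times> nat) set" where
  "endpoints C = {(0, i) | i. (0, i) \<in> C} \<union> {(1, i) | i. (2, i) \<in> C}"

definition tangle_concat :: "tangle \<Rightarrow> tangle \<Rightarrow> tangle" where
  "tangle_concat E E' = {endpoints C | C. C \<in> glued_components E E' \<and> endpoints C \<noteq> {}}"

definition closed_curves :: "tangle \<Rightarrow> tangle \<Rightarrow> nat" where
  "closed_curves E E' = card {C \<in> glued_components E E'. endpoints C = {}}"

definition id_tangle :: "nat \<Rightarrow> tangle" where
  "id_tangle n = {{(0, k), (1, k)} | k. k \<in> {1..n}}"

definition E_tangle :: "nat \<Rightarrow> nat \<Rightarrow> tangle" where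
  "E_tangle n i =
     {{(0, i), (0, i + 1)}, {(1, i), (1, i + 1)}} \<union>
     {{(0, k), (1, k)} | k. k \<in> {1..n} \<and> k \<noteq> i \<and> k \<noteq> i + 1}"

definition v_tangle :: "nat \<Rightarrow> nat \<Rightarrow> tangle" where
  "v_tangle n i =
     {{(0, i), (1, i + 1)}, {(0, i + 1), (1, i)}} \<union>
     {{(0, k), (1, k)} | k. k \<in> {1..n} \<and> k \<noteq> i \<and> k \<noteq> i + 1}"


section \<open>The virtual Temperley--Lieb algebra and the presented algebra\<close>

definition zvar :: "int poly" where
  "zvar = [:0, 1:]"

definition VTL :: "nat \<Rightarrow> (int poly, tangle \<Rightarrow>\<^sub>0 int poly) module" where
  "VTL n = based_algebra (flat_tangles n)
     (\<lambda>E E'. Poly_Mapping.single (tangle_concat E E') (zvar ^ closed_curves E E'))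
     (id_tangle n)"

datatype vtl_gen = GE nat | GV nat

definition vtl_gens :: "nat \<Rightarrow> vtl_gen set" where
  "vtl_gens n = GE ` {1..n - 1} \<union> GV ` {1..n - 1}"

inductive_set vtl_rels ::
    "nat \<Rightarrow> ((vtl_gen list \<Rightarrow>\<^sub>0 int poly) \<times> (vtl_gen list \<Rightarrow>\<^sub>0 int poly)) set"
  for n :: nat where
  E_square: "i \<in> {1..n - 1} \<Longrightarrow>
    (word [GE i, GE i], scale zvar (word [GE i])) \<in> vtl_rels n"
| v_square: "i \<in> {1..n - 1} \<Longrightarrow> (word [GV i, GV i], word []) \<in> vtl_rels n"
| E_v: "i \<in> {1..n - 1} \<Longrightarrow> (word [GE i, GV i], word [GE i]) \<in> vtl_rels n"
| v_E: "i \<in> {1..n - 1} \<Longrightarrow> (word [GV i, GE i], word [GE i]) \<in> vtl_rels n"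
| E_E_far: "\<lbrakk>i \<in> {1..n - 1}; j \<in> {1..n - 1}; \<bar>int i - int j\<bar> \<ge> 2\<rbrakk> \<Longrightarrow>
    (word [GE i, GE j], word [GE j, GE i]) \<in> vtl_rels n"
| v_v_far: "\<lbrakk>i \<in> {1..n - 1}; j \<in> {1..n - 1}; \<bar>int i - int j\<bar> \<ge> 2\<rbrakk> \<Longrightarrow>
    (word [GV i, GV j], word [GV j, GV i]) \<in> vtl_rels n"
| v_E_far: "\<lbrakk>i \<in> {1..n - 1}; j \<in> {1..n - 1}; \<bar>int i - int j\<bar> \<ge> 2\<rbrakk> \<Longrightarrow>
    (word [GV i, GE j], word [GE j, GV i]) \<in> vtl_rels n"
| E_E_E: "\<lbrakk>i \<in> {1..n - 1}; j \<in> {1..n - 1}; \<bar>int i - int j\<bar> = 1\<rbrakk> \<Longrightarrow>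
    (word [GE i, GE j, GE i], word [GE i]) \<in> vtl_rels n"
| v_v_v: "\<lbrakk>i \<in> {1..n - 1}; j \<in> {1..n - 1}; \<bar>int i - int j\<bar> = 1\<rbrakk> \<Longrightarrow>
    (word [GV i, GV j, GV i], word [GV j, GV i, GV j]) \<in> vtl_rels n"
| v_v_E: "\<lbrakk>i \<in> {1..n - 1}; j \<in> {1..n - 1}; \<bar>int i - int j\<bar> = 1\<rbrakk> \<Longrightarrow>
    (word [GV i, GV j, GE i], word [GE j, GV i, GV j]) \<in> vtl_rels n"

definition VTL' :: "nat \<Rightarrow> (int poly, (vtl_gen list \<Rightarrow>\<^sub>0 int poly) set) module" where
  "VTL' n = presented_algebra (vtl_gens n) (vtl_rels n)"

definition E' :: "nat \<Rightarrow> nat \<Rightarrow> (vtl_gen list \<Rightarrow>\<^sub>0 int poly) set" where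
  "E' n i = presented_gen (vtl_gens n) (vtl_rels n) (GE i)"

definition v' :: "nat \<Rightarrow> nat \<Rightarrow> (vtl_gen list \<Rightarrow>\<^sub>0 int poly) set" where
  "v' n i = presented_gen (vtl_gens n) (vtl_rels n) (GV i)"

definition is_vtl_phi ::
    "nat \<Rightarrow> ((vtl_gen list \<Rightarrow>\<^sub>0 int poly) set \<Rightarrow> (tangle \<Rightarrow>\<^sub>0 int poly)) \<Rightarrow> bool" where
  "is_vtl_phi n \<phi> \<longleftrightarrow>
     \<phi> \<in> alg_hom (VTL' n) (VTL n) \<and>
     (\<forall>i\<in>{1..n - 1}. \<phi> (E' n i) = Poly_Mapping.single (E_tangle n i) 1 \<and>
                       \<phi> (v' n i) = Poly_Mapping.single (v_tangle n i) 1)"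

end

theory Submission
  imports Defs "HOL-Combinatorics.Transposition"
begin

text \<open>
  Gluing is a statement about connected components: eliminating the middle layer of two glued
  tangles commutes with gluing a third one, so concatenation is associative and the numbers of
  closed curves satisfy the corresponding cocycle identity. A tangle is encoded by the
  fixed-point-free involution that exchanges the ends of its arcs. Left multiplication by \<open>v\<^sub>i\<close>
  conjugates the involution by a transposition of top points, and left multiplication by \<open>E\<^sub>i\<close> joins
  the partners of two adjacent top points; this gives the relations, hence \<open>\<phi>\<close>, and an inductive
  reduction of every tangle to the identity, hence surjectivity. Finally \<open>E\<^sub>1 v\<^sub>2 E\<^sub>1 = E\<^sub>1\<close> holds for
  tangles, but fails in the presented algebra, because \<open>z \<mapsto> -1\<close>, \<open>E\<^sub>i \<mapsto> -1\<close>, \<open>v\<^sub>i \<mapsto> 1\<close> respects all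
  defining relations.
\<close>

section \<open>Connected components of families of sets\<close>

text \<open>Only left multiplication by single generators is computed from pictures; a word is
  evaluated by letting its letters act one after another, and associativity makes this evaluation
  multiplicative. Associativity is proved for finite two-layered families of sets of any size rather
  than for arcs: deleting a layer from the components of a first gluing then yields legitimate
  blocks for a second one, and no path has to be followed. Since z is not invertible, producing a
  multiple of each tangle would not give surjectivity; the reduction must avoid closed curves at
  every step. Every defining relation preserves the parity of the number of letters E plus the
  exponent of z, whereas \<open>E\<^sub>1 v\<^sub>2 E\<^sub>1 = E\<^sub>1\<close> changes it. This
  identity of tangles closes no curve, so no power of z can repair the parity. A map with the
  prescribed values on generators is determined on the carrier only; hence uniqueness is claimed
  among extensional maps, while surjectivity and failure of injectivity concern every such
  map.\<close>

definition edge_rel :: "'a set set \<Rightarrow> ('a \<times> 'a) set" where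
  "edge_rel H = {(x, y). \<exists>p\<in>H. x \<in> p \<and> y \<in> p}"

text \<open>Two points of one block are related, each point to itself included, so the transitive
  closure is already an equivalence on the covered points and relates nothing else.\<close>

definition components :: "'a set set \<Rightarrow> 'a set set" where
  "components H = \<Union>H // (edge_rel H)\<^sup>+"

lemma glued_components_eq: "glued_components E F = components (glued_edges E F)"
  by (simp add: glued_components_def components_def edge_rel_def)

lemma edge_rel_Un: "edge_rel (H \<union> K) = edge_rel H \<union> edge_rel K"
  by (auto simp: edge_rel_def)

lemma edge_rel_mono: "H \<subseteq> K \<Longrightarrow> edge_rel H \<subseteq> edge_rel K"
  by (auto simp: edge_rel_def)

lemma sym_connected: "sym ((edge_rel H)\<^sup>+)"
  by (rule sym_trancl) (auto simp: sym_def edge_rel_def)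

lemma connected_sub: "(edge_rel H)\<^sup>+ \<subseteq> \<Union>H \<times> \<Union>H"
  by (rule trancl_subset_Sigma) (auto simp: edge_rel_def)

lemma connected_refl: "x \<in> \<Union>H \<Longrightarrow> (x, x) \<in> (edge_rel H)\<^sup>+"
  by (rule r_into_trancl) (auto simp: edge_rel_def)

lemma edge_connected: "p \<in> H \<Longrightarrow> x \<in> p \<Longrightarrow> y \<in> p \<Longrightarrow> (x, y) \<in> (edge_rel H)\<^sup>+"
  by (rule r_into_trancl) (auto simp: edge_rel_def)

lemma equiv_connected: "equiv (\<Union>H) ((edge_rel H)\<^sup>+)"
  using connected_sub[of H] sym_connected[of H]
  by (auto intro!: equivI refl_onI connected_refl)

lemma connected_iff_rtrancl:
  "x \<in> \<Union>H \<Longrightarrow> (x, y) \<in> (edge_rel H)\<^sup>+ \<longleftrightarrow> (x, y) \<in> (edge_rel H)\<^sup>*"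
  using connected_refl[of x H] by (auto simp: rtrancl_eq_or_trancl)

lemma components_eq: "components H = {(edge_rel H)\<^sup>+ `` {x} | x. x \<in> \<Union>H}"
  by (auto simp: components_def quotient_def)

lemma components_sub: "C \<in> components H \<Longrightarrow> C \<subseteq> \<Union>H"
  using connected_sub[of H] by (auto simp: components_eq)

lemma components_disjoint: "C \<in> components H \<Longrightarrow> D \<in> components H \<Longrightarrow> x \<in> C \<Longrightarrow> x \<in> D \<Longrightarrow> C = D"
  unfolding components_def using quotient_disj[OF equiv_connected, of C H D] by blast

lemma Union_components: "\<Union>(components H) = \<Union>H"
  unfolding components_def by (rule Union_quotient[OF equiv_connected])

lemma component_closed:
  "C \<in> components H \<Longrightarrow> x \<in> C \<Longrightarrow> (x, y) \<in> (edge_rel H)\<^sup>+ \<Longrightarrow> y \<in> C"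
  unfolding components_def by (rule in_quotient_imp_closed[OF equiv_connected])

lemma component_connected:
  "C \<in> components H \<Longrightarrow> x \<in> C \<Longrightarrow> y \<in> C \<Longrightarrow> (x, y) \<in> (edge_rel H)\<^sup>+"
  unfolding components_def by (rule in_quotient_imp_in_rel[OF equiv_connected]) auto

lemma component_eq_image: "C \<in> components H \<Longrightarrow> x \<in> C \<Longrightarrow> C = (edge_rel H)\<^sup>+ `` {x}"
  using component_closed[of C H x] component_connected[of C H x] by auto

lemma finite_components: "finite (\<Union>H) \<Longrightarrow> finite (components H)"
  using finite_UnionD[of "components H"] by (simp add: Union_components)

text \<open>A path among the image blocks pulls back edge by edge: consecutive edges share a point,
  and injectivity makes their preimages share one too.\<close>

lemma connected_image:
  assumes "inj f"
  shows "(edge_rel ((`) f ` H))\<^sup>+ = map_prod f f ` (edge_rel H)\<^sup>+"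
proof -
  have 1: "edge_rel ((`) f ` H) = map_prod f f ` edge_rel H"
    by (force simp: edge_rel_def)
  have "(x, y) \<in> map_prod f f ` (edge_rel H)\<^sup>+" if "(x, y) \<in> (edge_rel ((`) f ` H))\<^sup>+" for x y
    using that
  proof (induction rule: trancl_induct)
    case (base y)
    then show ?case unfolding 1 by auto
  next
    case (step y z)
    then obtain a b c d where "x = f a" "y = f b" "(a, b) \<in> (edge_rel H)\<^sup>+" "y = f c" "z = f d"
      "(c, d) \<in> edge_rel H" unfolding 1 by auto
    moreover have "b = c" using calculation assms by (auto dest: injD)
    ultimately show ?case by (metis map_prod_imageI trancl.trancl_into_trancl)
  qed
  moreover have "(f x, f y) \<in> (edge_rel ((`) f ` H))\<^sup>+" if "(x, y) \<in> (edge_rel H)\<^sup>+" for x y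
    using that by (induction rule: trancl_induct) (auto simp: 1 intro: trancl_into_trancl)
  ultimately show ?thesis by auto
qed

lemma components_image:
  assumes "inj f"
  shows "components ((`) f ` H) = (`) f ` components H"
proof -
  have im: "(edge_rel ((`) f ` H))\<^sup>+ `` {f x} = f ` ((edge_rel H)\<^sup>+ `` {x})" for x
    unfolding connected_image[OF assms] using assms by (auto simp: inj_eq)
  show ?thesis
  proof (intro equalityI subsetI)
    fix C assume "C \<in> components ((`) f ` H)"
    then obtain x where "x \<in> \<Union>H" "C = (edge_rel ((`) f ` H))\<^sup>+ `` {f x}"
      by (auto simp: components_eq)
    then show "C \<in> (`) f ` components H" unfolding im by (auto simp: components_eq)
  next
    fix C assume "C \<in> (`) f ` components H"
    then obtain x where "x \<in> \<Union>H" "C = f ` ((edge_rel H)\<^sup>+ `` {x})"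
      by (auto simp: components_eq)
    then show "C \<in> components ((`) f ` H)" unfolding im[symmetric] by (auto simp: components_eq)
  qed
qed

text \<open>Vertex elimination: connectivity between surviving points is recorded by single blocks,
  so that a later gluing need not mention \<open>A\<close>. Components inside \<open>A\<close> leave
  no trace here; \<open>components_within\<close> accounts for them.\<close>

definition reduce :: "'a set \<Rightarrow> 'a set set \<Rightarrow> 'a set set" where
  "reduce A H = {C - A | C. C \<in> components H \<and> C - A \<noteq> {}}"

lemma reduce_eq: "reduce A H = (\<lambda>C. C - A) ` components H - {{}}"
  unfolding reduce_def by blast

lemma reduce_image:
  assumes "inj f"
  shows "reduce (f ` A) ((`) f ` H) = (`) f ` reduce A H"
proof -
  have "(\<lambda>C. C - f ` A) ` (`) f ` components H = (`) f ` (\<lambda>C. C - A) ` components H"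
    by (simp add: image_image image_set_diff[OF assms])
  moreover have "(`) f ` (X - {{}}) = (`) f ` X - {{}}" for X
    by blast
  ultimately show ?thesis
    unfolding reduce_eq components_image[OF assms] by simp
qed

lemma Union_reduce: "\<Union>(reduce A H) = \<Union>H - A"
proof -
  have "\<Union>((\<lambda>C. C - A) ` X - {{}}) = \<Union>X - A" for X :: "'a set set"
    by blast
  then show ?thesis by (simp add: reduce_eq Union_components)
qed

lemma trancl_subset_trans: "r \<subseteq> s\<^sup>+ \<Longrightarrow> r\<^sup>+ \<subseteq> s\<^sup>+"
  using trancl_mono_subset[of r "s\<^sup>+"] by simp

text \<open>Blocks of \<open>K\<close> avoid \<open>A\<close>, so a path between points outside
  \<open>A\<close> can enter \<open>A\<close> only during a stretch of steps in \<open>H\<close>.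
  Such a stretch starts and ends outside \<open>A\<close> and is replaced by one block of
  \<open>reduce A H\<close>.\<close>

lemma connected_reduce:
  assumes "A \<inter> \<Union>K = {}"
  shows "(edge_rel (reduce A H \<union> K))\<^sup>+ = (edge_rel (H \<union> K))\<^sup>+ \<inter> (- A) \<times> (- A)" (is "?R\<^sup>+ = ?S\<^sup>+ \<inter> _")
proof (intro equalityI subrelI)
  fix x y assume "(x, y) \<in> ?R\<^sup>+"
  moreover have "?R\<^sup>+ \<subseteq> \<Union>(reduce A H \<union> K) \<times> \<Union>(reduce A H \<union> K)" by (rule connected_sub)
  moreover have "\<Union>(reduce A H \<union> K) \<subseteq> - A" using assms Union_reduce[of A H] by auto
  moreover have "?R \<subseteq> ?S\<^sup>+"
  proof
    fix z assume z: "z \<in> ?R"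
    obtain a b where [simp]: "z = (a, b)" by force
    have "(a, b) \<in> edge_rel K \<or> (a, b) \<in> (edge_rel H)\<^sup>+"
      using z unfolding edge_rel_Un by (auto simp: edge_rel_def reduce_def intro: component_connected[unfolded edge_rel_def])
    then show "z \<in> ?S\<^sup>+"
      by (metis \<open>z = (a, b)\<close> edge_rel_Un r_into_trancl' subsetD sup_ge1 sup_ge2 trancl_mono)
  qed
  then have "?R\<^sup>+ \<subseteq> ?S\<^sup>+" by (rule trancl_subset_trans)
  ultimately show "(x, y) \<in> ?S\<^sup>+ \<inter> (- A) \<times> (- A)" by blast
next
  fix x y assume "(x, y) \<in> ?S\<^sup>+ \<inter> (- A) \<times> (- A)"
  then have xy: "(x, y) \<in> ?S\<^sup>*" and A: "x \<notin> A" "y \<notin> A" and x: "x \<in> \<Union>(H \<union> K)"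
    using connected_sub[of "H \<union> K"] by auto
  have merge: "(u, v) \<in> ?R\<^sup>*" if "(u, v) \<in> (edge_rel H)\<^sup>*" "u \<notin> A" "v \<notin> A" for u v
  proof (cases "u = v")
    case False
    then have uv: "(u, v) \<in> (edge_rel H)\<^sup>+" using that by (simp add: rtrancl_eq_or_trancl)
    then have u: "u \<in> \<Union>H" using connected_sub by fast
    define C where "C = (edge_rel H)\<^sup>+ `` {u}"
    have "C \<in> components H" using u by (auto simp: C_def components_eq)
    moreover have "u \<in> C - A" "v \<in> C - A" using uv u that connected_refl[OF u] by (auto simp: C_def)
    ultimately have "(u, v) \<in> ?R" unfolding edge_rel_def reduce_def by blast
    then show ?thesis by auto
  qed auto
  \<comment> \<open>Invariant along the path: everything up to \<open>w\<close> has been translated,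
    and from \<open>w\<close> on only steps in \<open>H\<close> are pending. A step in
    \<open>K\<close> closes the pending stretch through \<open>merge\<close> and moves
    \<open>w\<close> to its own end.\<close>
  have "\<exists>w. w \<notin> A \<and> (x, w) \<in> ?R\<^sup>* \<and> (w, y) \<in> (edge_rel H)\<^sup>*"
    using xy
  proof (induction rule: rtrancl_induct)
    case base
    then show ?case using A by auto
  next
    case (step y z)
    then obtain w where w: "w \<notin> A" "(x, w) \<in> ?R\<^sup>*" "(w, y) \<in> (edge_rel H)\<^sup>*" by blast
    show ?case
    proof (cases "(y, z) \<in> edge_rel H")
      case True
      then show ?thesis using w by (meson rtrancl.rtrancl_into_rtrancl)
    next
      case False
      then have yz: "(y, z) \<in> edge_rel K" using step by (auto simp: edge_rel_Un)
      then have "y \<notin> A" "z \<notin> A" using assms by (auto simp: edge_rel_def)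
      moreover have "(y, z) \<in> ?R" using yz by (auto simp: edge_rel_Un)
      ultimately show ?thesis using merge[OF w(3,1)] w(2)
        by (meson rtrancl.rtrancl_into_rtrancl rtrancl.rtrancl_refl rtrancl_trans)
    qed
  qed
  then have "(x, y) \<in> ?R\<^sup>*" using merge A by (meson rtrancl_trans)
  moreover have "x \<in> \<Union>(reduce A H \<union> K)" using x A by (auto simp: Union_reduce Union_Un_distrib)
  ultimately show "(x, y) \<in> ?R\<^sup>+" using connected_iff_rtrancl[of x "reduce A H \<union> K" y] by simp
qed

text \<open>By \<open>connected_reduce\<close>, the classes on the left are those of
  \<open>H \<union> K\<close> with \<open>A\<close> cut off. Elimination can thus be postponed until
  everything has been glued, which is the core of associativity.\<close>

lemma components_reduce:
  assumes "A \<inter> \<Union>K = {}"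
  shows "components (reduce A H \<union> K) = reduce A (H \<union> K)"
proof -
  have U: "\<Union>(reduce A H \<union> K) = \<Union>(H \<union> K) - A"
    using assms by (auto simp: Union_reduce Union_Un_distrib)
  have im: "(edge_rel (reduce A H \<union> K))\<^sup>+ `` {x} = (edge_rel (H \<union> K))\<^sup>+ `` {x} - A" if "x \<notin> A" for x
    using that unfolding connected_reduce[OF assms] by auto
  show ?thesis
  proof (intro equalityI subsetI)
    fix C assume "C \<in> components (reduce A H \<union> K)"
    then obtain x where x: "x \<in> \<Union>(H \<union> K)" "x \<notin> A" and C: "C = (edge_rel (H \<union> K))\<^sup>+ `` {x} - A"
      unfolding components_eq U using im by auto
    have "x \<in> C" using x connected_refl[OF x(1)] C by simp
    moreover have "(edge_rel (H \<union> K))\<^sup>+ `` {x} \<in> components (H \<union> K)" using x by (auto simp: components_eq)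
    ultimately show "C \<in> reduce A (H \<union> K)" unfolding reduce_def using C by blast
  next
    fix C assume "C \<in> reduce A (H \<union> K)"
    then obtain D x where D: "D \<in> components (H \<union> K)" "C = D - A" "x \<in> C" unfolding reduce_def by blast
    then have "D = (edge_rel (H \<union> K))\<^sup>+ `` {x}" by (intro component_eq_image) auto
    moreover have "x \<notin> A" "x \<in> \<Union>(H \<union> K)" using D components_sub[OF D(1)] by auto
    ultimately show "C \<in> components (reduce A H \<union> K)"
      unfolding components_eq U using im D(2) by blast
  qed
qed

text \<open>A class confined to \<open>A\<close> is never met by a block of \<open>K\<close>. Hence
  curves closed in a first gluing are neither altered nor joined by a second one, and no new curve
  can arise inside \<open>A\<close>.\<close>

lemma components_within:
  assumes "A \<inter> \<Union>K = {}"
  shows "{C \<in> components (H \<union> K). C \<subseteq> A} = {C \<in> components H. C \<subseteq> A}"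
proof -
  \<comment> \<open>The disjunction serves both inclusions: confinement of the larger class or of
    the smaller one keeps the path in \<open>A\<close>, where only blocks of \<open>H\<close> are
    available.\<close>
  have step: "(x, y) \<in> (edge_rel H)\<^sup>+"
    if "x \<in> \<Union>H" "(x, y) \<in> (edge_rel (H \<union> K))\<^sup>*" 
      "(edge_rel (H \<union> K))\<^sup>+ `` {x} \<subseteq> A \<or> (edge_rel H)\<^sup>+ `` {x} \<subseteq> A" for x y
    using that(2)
  proof (induction rule: rtrancl_induct)
    case base
    then show ?case using connected_refl[OF that(1)] by simp
  next
    case (step y z)
    have "(edge_rel H)\<^sup>+ \<subseteq> (edge_rel (H \<union> K))\<^sup>+" 
      by (simp add: edge_rel_mono trancl_mono_subset)
    then have "y \<in> A" using that(3) step.IH by blast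
    then have "(y, z) \<in> edge_rel H" using step assms by (auto simp: edge_rel_def)
    then show ?case using step.IH by simp
  qed
  have eq: "(edge_rel (H \<union> K))\<^sup>+ `` {x} = (edge_rel H)\<^sup>+ `` {x}"
    if "x \<in> \<Union>H" "(edge_rel (H \<union> K))\<^sup>+ `` {x} \<subseteq> A \<or> (edge_rel H)\<^sup>+ `` {x} \<subseteq> A" for x
  proof -
    have "(edge_rel H)\<^sup>+ \<subseteq> (edge_rel (H \<union> K))\<^sup>+" 
      by (simp add: edge_rel_mono trancl_mono_subset)
    then show ?thesis using step[OF that(1) _ that(2)] by (auto dest: trancl_into_rtrancl)
  qed
  show ?thesis
  proof (intro equalityI subsetI)
    fix C assume "C \<in> {C \<in> components (H \<union> K). C \<subseteq> A}"
    then obtain x where x: "x \<in> \<Union>(H \<union> K)" "C = (edge_rel (H \<union> K))\<^sup>+ `` {x}" "C \<subseteq> A"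
      by (auto simp: components_eq)
    then have "x \<in> A" using connected_refl[OF x(1)] by auto
    then have "x \<in> \<Union>H" using x assms by auto
    then show "C \<in> {C \<in> components H. C \<subseteq> A}" using eq x by (auto simp: components_eq)
  next
    fix C assume "C \<in> {C \<in> components H. C \<subseteq> A}"
    then obtain x where x: "x \<in> \<Union>H" "C = (edge_rel H)\<^sup>+ `` {x}" "C \<subseteq> A"
      by (auto simp: components_eq)
    then show "C \<in> {C \<in> components (H \<union> K). C \<subseteq> A}"
      using eq[OF x(1)] by (auto simp: components_eq)
  qed
qed

section \<open>Concatenation is associative\<close>

text \<open>Applied once for each bracketing of three tangles: \<open>H\<close> is the first gluing,
  \<open>A\<close> its middle layer, \<open>K\<close> the third tangle, and \<open>X\<close> the
  second gluing, which \<open>\<rho>\<close> renames into the threefold one. Reduction drops exactly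
  the components inside \<open>A\<close>, and the others correspond to those of \<open>X\<close>;
  adding the curves already closed in \<open>H\<close> gives the total count.\<close>

lemma component_transfer:
  fixes \<rho> :: "'a \<Rightarrow> 'b" and P :: "'a set \<Rightarrow> 'c set" and Q :: "'b set \<Rightarrow> 'c set"
  assumes \<rho>: "inj \<rho>" and X: "(`) \<rho> ` X = reduce A H \<union> K" and K: "A \<inter> \<Union>K = {}"
    and PQ: "\<And>C D. \<rho> ` D = C - A \<Longrightarrow> P D = Q C" and Q: "\<And>C. C \<subseteq> A \<Longrightarrow> Q C = {}"
  shows "{P D | D. D \<in> components X \<and> P D \<noteq> {}} = {Q C | C. C \<in> components (H \<union> K) \<and> Q C \<noteq> {}}"
    and "finite (components (H \<union> K)) \<Longrightarrow>
      card {C \<in> components H. C \<subseteq> A} + card {D \<in> components X. P D = {}} =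
        card {C \<in> components (H \<union> K). Q C = {}}"
proof -
  have X': "(`) \<rho> ` components X = reduce A (H \<union> K)"
    by (simp add: components_image[OF \<rho>, symmetric] X components_reduce[OF K])
  have fwd: "\<exists>C\<in>components (H \<union> K). \<rho> ` D = C - A \<and> \<not> C \<subseteq> A" if "D \<in> components X" for D
  proof -
    have "\<rho> ` D \<in> reduce A (H \<union> K)" unfolding X'[symmetric] using that by (rule imageI)
    then show ?thesis unfolding reduce_def by auto
  qed
  have bwd: "\<exists>D\<in>components X. \<rho> ` D = C - A" if "C \<in> components (H \<union> K)" "\<not> C \<subseteq> A" for C
  proof -
    have "C - A \<in> (`) \<rho> ` components X" unfolding X' reduce_def using that by auto
    then show ?thesis by auto
  qed
  show "{P D | D. D \<in> components X \<and> P D \<noteq> {}} = {Q C | C. C \<in> components (H \<union> K) \<and> Q C \<noteq> {}}"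
  proof (intro equalityI subsetI)
    fix x assume "x \<in> {P D | D. D \<in> components X \<and> P D \<noteq> {}}"
    then obtain D where D: "x = P D" "D \<in> components X" "P D \<noteq> {}" by blast
    obtain C where C: "C \<in> components (H \<union> K)" "\<rho> ` D = C - A" using fwd[OF D(2)] by blast
    then show "x \<in> {Q C | C. C \<in> components (H \<union> K) \<and> Q C \<noteq> {}}" using PQ[OF C(2)] D by blast
  next
    fix x assume "x \<in> {Q C | C. C \<in> components (H \<union> K) \<and> Q C \<noteq> {}}"
    then obtain C where C: "x = Q C" "C \<in> components (H \<union> K)" "Q C \<noteq> {}" by blast
    then have "\<not> C \<subseteq> A" using Q by auto
    then obtain D where D: "D \<in> components X" "\<rho> ` D = C - A" using bwd C by blast
    then show "x \<in> {P D | D. D \<in> components X \<and> P D \<noteq> {}}" using PQ[OF D(2)] C by blast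
  qed
  assume fin: "finite (components (H \<union> K))"
  \<comment> \<open>The closed curves of the threefold gluing that only the second gluing
    closes.\<close>
  let ?T = "{C \<in> components (H \<union> K). \<not> C \<subseteq> A \<and> Q C = {}}"
  have im: "(`) \<rho> ` {D \<in> components X. P D = {}} = (\<lambda>C. C - A) ` ?T"
  proof (intro equalityI subsetI)
    fix x assume "x \<in> (`) \<rho> ` {D \<in> components X. P D = {}}"
    then obtain D where D: "x = \<rho> ` D" "D \<in> components X" "P D = {}" by blast
    obtain C where C: "C \<in> components (H \<union> K)" "\<rho> ` D = C - A" "\<not> C \<subseteq> A" using fwd[OF D(2)] by blast
    then have "C \<in> ?T" using PQ[OF C(2)] D by simp
    then show "x \<in> (\<lambda>C. C - A) ` ?T" using C(2) D(1) by (intro image_eqI) simp_all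
  next
    fix x assume "x \<in> (\<lambda>C. C - A) ` ?T"
    then obtain C where C: "x = C - A" "C \<in> components (H \<union> K)" "\<not> C \<subseteq> A" "Q C = {}" by blast
    then obtain D where D: "D \<in> components X" "\<rho> ` D = C - A" using bwd by blast
    then have "D \<in> {D \<in> components X. P D = {}}" using PQ[OF D(2)] C by simp
    then show "x \<in> (`) \<rho> ` {D \<in> components X. P D = {}}" using C(1) D(2) by (intro image_eqI) simp_all
  qed
  have inj1: "inj_on ((`) \<rho>) {D \<in> components X. P D = {}}"
    using \<rho> by (auto simp: inj_on_def inj_image_eq_iff)
  \<comment> \<open>A component not inside \<open>A\<close> keeps a point when \<open>A\<close> is
    deleted, and a point determines its component.\<close>
  have inj2: "inj_on (\<lambda>C. C - A) ?T"
  proof (rule inj_onI)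
    fix C D assume CD: "C \<in> ?T" "D \<in> ?T" "C - A = D - A"
    then obtain x where "x \<in> C" "x \<in> D" by blast
    then show "C = D" using CD components_disjoint[of C "H \<union> K" D x] by simp
  qed
  have "card {D \<in> components X. P D = {}} = card ?T"
    using card_image[OF inj1] card_image[OF inj2] im by simp
  moreover have "{C \<in> components (H \<union> K). Q C = {}} = {C \<in> components (H \<union> K). C \<subseteq> A} \<union> ?T"
    using Q by auto
  then have "card {C \<in> components (H \<union> K). Q C = {}} = card {C \<in> components (H \<union> K). C \<subseteq> A} + card ?T"
    using fin by (simp only:) (rule card_Un_disjoint; auto)
  ultimately show "card {C \<in> components H. C \<subseteq> A} + card {D \<in> components X. P D = {}} =
        card {C \<in> components (H \<union> K). Q C = {}}"
    by (simp add: components_within[OF K])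
qed

section \<open>Layers of glued tangles and their renamings\<close>

abbreviation shift :: "nat \<times> nat \<Rightarrow> nat \<times> nat" where
  "shift \<equiv> apfst Suc"

abbreviation layer :: "nat \<Rightarrow> (nat \<times> nat) set" where
  "layer j \<equiv> {j} \<times> UNIV"

definition two_layered :: "tangle \<Rightarrow> bool" where
  "two_layered E \<longleftrightarrow> \<Union>E \<subseteq> {0, 1} \<times> UNIV"

text \<open>These renamings make room for the layer along which two of three tangles have been glued.\<close>

definition skip1 :: "nat \<times> nat \<Rightarrow> nat \<times> nat" where
  "skip1 = apfst (\<lambda>a. if a = 0 then 0 else Suc a)"

definition skip2 :: "nat \<times> nat \<Rightarrow> nat \<times> nat" where
  "skip2 = apfst (\<lambda>a. if a \<le> 1 then a else Suc a)"

lemma inj_renaming: "inj shift" "inj skip1" "inj skip2"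
  by (auto simp: inj_def skip1_def skip2_def split: if_splits)

lemma Union_glued_edges:
  "two_layered E \<Longrightarrow> two_layered F \<Longrightarrow> \<Union>(glued_edges E F) \<subseteq> {0, 1, 2} \<times> UNIV"
  by (fastforce simp: two_layered_def glued_edges_def)

text \<open>\<open>endpoints\<close> forgets layer 1 and renames layer 2 to 1; \<open>skip1\<close>
  undoes the renaming. This turns endpoints into the set difference on which \<open>reduce\<close>
  is based.\<close>

lemma skip1_endpoints: "C \<subseteq> {0, 1, 2} \<times> UNIV \<Longrightarrow> skip1 ` endpoints C = C - layer 1"
proof -
  assume C: "C \<subseteq> {0, 1, 2} \<times> UNIV"
  have "(a, k) \<in> skip1 ` endpoints C" if "(a, k) \<in> C" "a \<noteq> 1" for a k
  proof -
    have "a = 0 \<or> a = 2" using C that by auto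
    then show ?thesis
    proof
      assume "a = 0"
      then show ?thesis using that by (intro image_eqI[of _ _ "(0, k)"]) (auto simp: endpoints_def skip1_def)
    next
      assume "a = 2"
      then show ?thesis using that by (intro image_eqI[of _ _ "(1, k)"]) (auto simp: endpoints_def skip1_def)
    qed
  qed
  moreover have "skip1 ` endpoints C \<subseteq> C - layer 1"
    by (auto simp: endpoints_def skip1_def simp flip: numeral_2_eq_2)
  ultimately show ?thesis by auto
qed

lemma endpoints_empty_iff: "C \<subseteq> {0, 1, 2} \<times> UNIV \<Longrightarrow> endpoints C = {} \<longleftrightarrow> C \<subseteq> layer 1"
  using skip1_endpoints[of C] by auto

lemma skip1_concat:
  assumes "two_layered E" "two_layered F"
  shows "(`) skip1 ` tangle_concat E F = reduce (layer 1) (glued_edges E F)"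
proof -
  have "skip1 ` endpoints C = C - layer 1" "endpoints C \<noteq> {} \<longleftrightarrow> C - layer 1 \<noteq> {}"
    if "C \<in> components (glued_edges E F)" for C
    using components_sub[OF that] Union_glued_edges[OF assms] skip1_endpoints[of C]
      endpoints_empty_iff[of C] by auto
  then show ?thesis
    unfolding tangle_concat_def reduce_def glued_components_eq image_Collect
    by (intro Collect_cong) metis
qed

lemma closed_curves_eq:
  assumes "two_layered E" "two_layered F"
  shows "closed_curves E F = card {C \<in> components (glued_edges E F). C \<subseteq> layer 1}"
proof -
  have "endpoints C = {} \<longleftrightarrow> C \<subseteq> layer 1" if "C \<in> components (glued_edges E F)" for C
    using components_sub[OF that] Union_glued_edges[OF assms] endpoints_empty_iff[of C] by auto
  then show ?thesis unfolding closed_curves_def glued_components_eq by (intro arg_cong[where f = card]) auto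
qed

text \<open>Both ways of concatenating three tangles are read off the components of all three glued at once.\<close>

lemma tangle_concat_assoc:
  assumes E: "two_layered E" and F: "two_layered F" and G: "two_layered G"
    and fin: "finite (\<Union>E)" "finite (\<Union>F)" "finite (\<Union>G)"
  shows "tangle_concat (tangle_concat E F) G = tangle_concat E (tangle_concat F G)"
    and "closed_curves E F + closed_curves (tangle_concat E F) G =
         closed_curves F G + closed_curves E (tangle_concat F G)"
proof -
  \<comment> \<open>The threefold gluing \<open>T\<close> occupies layers 0 to 3, so its free ends
    lie in layers 0 and 3, where \<open>endpoints\<close> looks at 0 and 2.\<close>
  define ends :: "(nat \<times> nat) set \<Rightarrow> (nat \<times> nat) set" where
    "ends C = {(0, i) | i. (0, i) \<in> C} \<union> {(1, i) | i. (3, i) \<in> C}" for C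
  define T where "T = E \<union> (`) shift ` F \<union> (`) shift ` (`) shift ` G"
  have G3: "layer 1 \<inter> \<Union>((`) shift ` (`) shift ` G) = {}" by auto
  have E3: "layer 2 \<inter> \<Union>E = {}" using E by (force simp: two_layered_def)
  have T1: "T = glued_edges E F \<union> (`) shift ` (`) shift ` G"
    by (simp add: T_def glued_edges_def)
  have T2: "T = (`) shift ` glued_edges F G \<union> E"
    by (auto simp: T_def glued_edges_def image_Un)
  have "\<Union>T = \<Union>E \<union> shift ` \<Union>F \<union> shift ` shift ` \<Union>G"
    unfolding T_def image_Union by simp
  then have finT: "finite (components T)"
    using fin by (intro finite_components) simp
  \<comment> \<open>First bracketing: the layer between \<open>E\<close> and \<open>F\<close> is
    layer 1. Reopening it pushes the already shifted \<open>G\<close> down once more, to its place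
    in \<open>T\<close>.\<close>
  have "(`) skip1 ` glued_edges (tangle_concat E F) G =
      reduce (layer 1) (glued_edges E F) \<union> (`) shift ` (`) shift ` G"
  proof -
    have "skip1 ` shift ` p = shift ` shift ` p" for p
      unfolding image_image by (rule image_cong) (auto simp: skip1_def)
    then show ?thesis
      unfolding glued_edges_def[of "tangle_concat E F"] image_Un skip1_concat[OF E F] by (simp add: image_image)
  qed
  note l = component_transfer[OF inj_renaming(2) this G3, where P = endpoints and Q = ends, folded T1]
  \<comment> \<open>Second bracketing: the layer between \<open>F\<close> and \<open>G\<close> is
    layer 2, because both lie below \<open>E\<close>. Reopening it leaves \<open>E\<close> in
    place.\<close>
  have "(`) skip2 ` glued_edges E (tangle_concat F G) =
      reduce (layer 2) ((`) shift ` glued_edges F G) \<union> E"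
  proof -
    have "skip2 ` p = p" if "p \<in> E" for p
    proof -
      have "skip2 x = x" if "x \<in> p" for x
        using that \<open>p \<in> E\<close> E by (cases x) (force simp: two_layered_def skip2_def)
      then show ?thesis by simp
    qed
    then have 1: "(`) skip2 ` E = E" by simp
    have "skip2 ` shift ` p = shift ` skip1 ` p" for p
      unfolding image_image by (rule image_cong) (auto simp: skip1_def skip2_def)
    then have 2: "(`) skip2 ` (`) shift ` tangle_concat F G = (`) shift ` (`) skip1 ` tangle_concat F G"
      by (simp add: image_image)
    have 3: "layer 2 = shift ` layer 1" by (auto simp: image_iff)
    show ?thesis
      unfolding glued_edges_def[of E] image_Un 1 2 skip1_concat[OF F G] 3 reduce_image[OF inj_renaming(1)]
      by blast
  qed
  note r = component_transfer[OF inj_renaming(3) this E3, where P = endpoints and Q = ends, folded T2]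
  have ends1: "endpoints D = ends C" if "skip1 ` D = C - layer 1" for C D
  proof -
    have "skip1 (0, i) = (0, i)" "skip1 (2, i) = (3, i)" for i by (auto simp: skip1_def)
    then have "(0, i) \<in> skip1 ` D \<longleftrightarrow> (0, i) \<in> D" "(3, i) \<in> skip1 ` D \<longleftrightarrow> (2, i) \<in> D" for i
      by (metis inj_image_mem_iff inj_renaming(2))+
    then show ?thesis unfolding endpoints_def ends_def that by auto
  qed
  have ends2: "endpoints D = ends C" if "skip2 ` D = C - layer 2" for C D
  proof -
    have "skip2 (0, i) = (0, i)" "skip2 (2, i) = (3, i)" for i by (auto simp: skip2_def)
    then have "(0, i) \<in> skip2 ` D \<longleftrightarrow> (0, i) \<in> D" "(3, i) \<in> skip2 ` D \<longleftrightarrow> (2, i) \<in> D" for i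
      by (metis inj_image_mem_iff inj_renaming(3))+
    then show ?thesis unfolding endpoints_def ends_def that by auto
  qed
  have ends0: "C \<subseteq> layer 1 \<Longrightarrow> ends C = {}" "C \<subseteq> layer 2 \<Longrightarrow> ends C = {}" for C
    by (auto simp: ends_def)
  show "tangle_concat (tangle_concat E F) G = tangle_concat E (tangle_concat F G)"
    unfolding tangle_concat_def[of "tangle_concat E F"] tangle_concat_def[of E "tangle_concat F G"]
      glued_components_eq
    using l(1)[OF ends1 ends0(1)] r(1)[OF ends2 ends0(2)] by simp
  have "{C \<in> components ((`) shift ` glued_edges F G). C \<subseteq> layer 2} =
      (`) shift ` {C \<in> components (glued_edges F G). C \<subseteq> layer 1}"
  proof -
    have "shift ` C \<subseteq> layer 2 \<longleftrightarrow> C \<subseteq> layer 1" for C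
      by (auto simp: image_subset_iff)
    then show ?thesis unfolding components_image[OF inj_renaming(1)] by blast
  qed
  moreover have "inj_on ((`) shift) X" for X
    using inj_renaming(1) by (auto simp: inj_on_def inj_image_eq_iff)
  ultimately have "card {C \<in> components ((`) shift ` glued_edges F G). C \<subseteq> layer 2} = closed_curves F G"
    by (simp add: card_image closed_curves_eq[OF F G])
  then show "closed_curves E F + closed_curves (tangle_concat E F) G =
         closed_curves F G + closed_curves E (tangle_concat F G)"
    using l(2)[OF ends1 ends0(1) finT] r(2)[OF ends2 ends0(2) finT]
    unfolding closed_curves_eq[OF E F]
    unfolding closed_curves_def[of "tangle_concat E F"] closed_curves_def[of E "tangle_concat F G"]
      glued_components_eq
    by simp
qed

section \<open>Tangles as involutions\<close>

text \<open>Values off \<open>tangle_points n\<close> are arbitrary, so by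
  \<open>tangle_of_cong\<close> equality of tangles only asks for agreement on the points.\<close>

definition matching :: "nat \<Rightarrow> (nat \<times> nat \<Rightarrow> nat \<times> nat) \<Rightarrow> bool" where
  "matching n f \<longleftrightarrow>
     (\<forall>p\<in>tangle_points n. f p \<in> tangle_points n \<and> f p \<noteq> p \<and> f (f p) = p)"

definition tangle_of :: "nat \<Rightarrow> (nat \<times> nat \<Rightarrow> nat \<times> nat) \<Rightarrow> tangle" where
  "tangle_of n f = (\<lambda>p. {p, f p}) ` tangle_points n"

lemma tangle_points_iff [simp]: "(a, k) \<in> tangle_points n \<longleftrightarrow> a \<le> 1 \<and> 1 \<le> k \<and> k \<le> n"
  by (auto simp: tangle_points_def)

lemma finite_tangle_points: "finite (tangle_points n)"
  by (simp add: tangle_points_def)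

lemma matchingD:
  assumes "matching n f" "p \<in> tangle_points n"
  shows "f p \<in> tangle_points n" "f p \<noteq> p" "f (f p) = p"
  using assms by (auto simp: matching_def)

lemma tangle_of_cong: "(\<And>p. p \<in> tangle_points n \<Longrightarrow> f p = g p) \<Longrightarrow> tangle_of n f = tangle_of n g"
  by (simp add: tangle_of_def)

lemma Union_tangle_of: "matching n f \<Longrightarrow> \<Union>(tangle_of n f) = tangle_points n"
  unfolding tangle_of_def using matchingD(1)[of n f] by blast

lemma two_layered_tangle_of: "matching n f \<Longrightarrow> two_layered (tangle_of n f)"
  by (auto simp: two_layered_def Union_tangle_of)

lemma tangle_of_block:
  assumes f: "matching n f" and "e \<in> tangle_of n f" "x \<in> e"
  shows "e = {x, f x}"
proof -
  obtain p where p: "p \<in> tangle_points n" "e = {p, f p}" using assms(2) by (auto simp: tangle_of_def)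
  then consider "x = p" | "x = f p" using assms(3) by blast
  then show ?thesis using p(2) matchingD(3)[OF f p(1)] by cases (simp_all add: insert_commute)
qed

lemma tangle_of_flat:
  assumes f: "matching n f"
  shows "tangle_of n f \<in> flat_tangles n"
proof -
  have "disjoint (tangle_of n f)"
  proof (rule disjointI)
    fix a b assume "a \<in> tangle_of n f" "b \<in> tangle_of n f" "a \<noteq> b"
    then have False if "x \<in> a" "x \<in> b" for x
      using tangle_of_block[OF f, of a x] tangle_of_block[OF f, of b x] that by simp
    then show "a \<inter> b = {}" by blast
  qed
  moreover have "{} \<notin> tangle_of n f" by (auto simp: tangle_of_def)
  moreover have "card e = 2" if e: "e \<in> tangle_of n f" for e
  proof -
    obtain p where "p \<in> tangle_points n" "e = {p, f p}" using e unfolding tangle_of_def by blast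
    then show ?thesis using matchingD(2)[OF f, of p] by (metis card_2_iff)
  qed
  ultimately show ?thesis
    using Union_tangle_of[OF f] by (simp add: flat_tangles_def partition_on_def)
qed

text \<open>A block of two elements offers each of its points a partner. Disjointness of the blocks
  makes the choice of partners an involution.\<close>

lemma flat_tangle_is_matching:
  assumes "E \<in> flat_tangles n"
  obtains f where "matching n f" "E = tangle_of n f"
proof -
  have P: "partition_on (tangle_points n) E" and c2: "\<And>p. p \<in> E \<Longrightarrow> card p = 2"
    using assms by (auto simp: flat_tangles_def)
  have U: "\<Union>E = tangle_points n" using partition_onD1[OF P] by simp
  have "\<exists>q. q \<noteq> p \<and> {p, q} \<in> E" if "p \<in> tangle_points n" for p
  proof -
    have "p \<in> \<Union>E" using that U by simp
    then obtain B where B: "B \<in> E" "p \<in> B" by (rule UnionE)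
    obtain x y where xy: "B = {x, y}" "x \<noteq> y" using c2[OF B(1)] unfolding card_2_iff by blast
    show ?thesis
    proof (cases "p = x")
      case True
      then show ?thesis using B xy by (intro exI[of _ y]) simp
    next
      case False
      then show ?thesis using B xy by (intro exI[of _ x]) (simp add: insert_commute)
    qed
  qed
  then obtain f where f: "\<And>p. p \<in> tangle_points n \<Longrightarrow> f p \<noteq> p \<and> {p, f p} \<in> E" by metis
  have uniq: "B = B'" if "B \<in> E" "B' \<in> E" "x \<in> B" "x \<in> B'" for B B' x
    using disjointD[OF partition_onD2[OF P] that(1,2)] that(3,4) by blast
  have pts: "f p \<in> tangle_points n" if "p \<in> tangle_points n" for p
    unfolding U[symmetric] using f[OF that] by (intro UnionI[of "{p, f p}"]) auto
  have "f (f p) = p" if "p \<in> tangle_points n" for p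
  proof -
    have "{p, f p} = {f p, f (f p)}"
      using uniq[of "{p, f p}" "{f p, f (f p)}" "f p"] f[OF that] f[OF pts[OF that]] by simp
    then show ?thesis by (metis doubleton_eq_iff)
  qed
  then have "matching n f" using f pts by (simp add: matching_def)
  have "B \<in> tangle_of n f" if BE: "B \<in> E" for B
  proof -
    have "B \<noteq> {}" using c2[OF BE] by auto
    then obtain p where p: "p \<in> B" by blast
    then have "p \<in> tangle_points n" unfolding U[symmetric] using BE by (rule UnionI[rotated])
    moreover from this have "B = {p, f p}" using uniq[of B "{p, f p}" p] f BE p by simp
    ultimately show ?thesis by (simp add: tangle_of_def)
  qed
  moreover have "tangle_of n f \<subseteq> E" using f by (auto simp: tangle_of_def)
  ultimately have "E = tangle_of n f" by blast
  with \<open>matching n f\<close> show ?thesis by (rule that)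
qed

section \<open>Computing a concatenation from labels\<close>

lemma endpoints_skip1: "endpoints C = {p. fst p \<le> 1 \<and> skip1 p \<in> C}"
proof -
  have "p \<in> endpoints C \<longleftrightarrow> fst p \<le> 1 \<and> skip1 p \<in> C" for p
    by (cases p; cases "fst p = 0")
      (auto simp: endpoints_def skip1_def le_Suc_eq simp flip: numeral_2_eq_2)
  then show ?thesis by blast
qed

text \<open>
  Concatenations are computed by exhibiting a labelling of the glued points that is constant on
  components. Arcs carry the pair of their endpoints as label; \<open>N\<close> is the set of positions in the
  middle layer that lie on a closed curve, of which there is at most one.
\<close>

lemma concat_by_labels:
  assumes U: "\<Union>(glued_edges X Y) = {0, 1, 2} \<times> {1..n}" and f: "matching n f"
    and lab: "\<And>e x y. e \<in> glued_edges X Y \<Longrightarrow> x \<in> e \<Longrightarrow> y \<in> e \<Longrightarrow> L x = L y"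
    and arc: "\<And>p. p \<in> tangle_points n \<Longrightarrow> L (skip1 p) = {p, f p}"
    and conn: "\<And>p. p \<in> tangle_points n \<Longrightarrow> (skip1 p, skip1 (f p)) \<in> (edge_rel (glued_edges X Y))\<^sup>+"
    and mid: "\<And>k. k \<in> {1..n} - N \<Longrightarrow>
      \<exists>p\<in>tangle_points n. ((1, k), skip1 p) \<in> (edge_rel (glued_edges X Y))\<^sup>+"
    and N: "N \<subseteq> {1..n}" "\<And>k. k \<in> N \<Longrightarrow> L (1, k) = {}"
      "\<And>k l. k \<in> N \<Longrightarrow> l \<in> N \<Longrightarrow> ((1, k), (1, l)) \<in> (edge_rel (glued_edges X Y))\<^sup>+"
  shows "tangle_concat X Y = tangle_of n f" and "closed_curves X Y = (if N = {} then 0 else 1)"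
proof -
  let ?R = "(edge_rel (glued_edges X Y))\<^sup>+"
  have L: "L x = L y" if "(x, y) \<in> ?R" for x y
    using that by (induction rule: trancl_induct) (auto simp: edge_rel_def dest: lab)
  have skip_pt: "skip1 p \<in> \<Union>(glued_edges X Y)" if "p \<in> tangle_points n" for p
    unfolding U using that by (cases p) (auto simp: skip1_def)
  have pt_skip: "p \<in> tangle_points n" if "skip1 p \<in> \<Union>(glued_edges X Y)" "fst p \<le> 1" for p
    using that unfolding U by (cases p) (auto simp: skip1_def split: if_splits)
  \<comment> \<open>An endpoint \<open>q\<close> of this component has label
    \<open>{q, f q}\<close>, which must equal \<open>{p, f p}\<close>; so no third endpoint exists.
    Conversely \<open>conn\<close> puts both ends into the component.\<close>
  have arc_ends: "endpoints (?R `` {skip1 p}) = {p, f p}" if p: "p \<in> tangle_points n" for p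
  proof (intro equalityI subsetI)
    fix q assume "q \<in> endpoints (?R `` {skip1 p})"
    then have q: "fst q \<le> 1" "(skip1 p, skip1 q) \<in> ?R" by (auto simp: endpoints_skip1)
    then have "q \<in> tangle_points n" using pt_skip connected_sub[of "glued_edges X Y"] by blast
    then show "q \<in> {p, f p}" using L[OF q(2)] arc p by auto
  next
    fix q assume "q \<in> {p, f p}"
    moreover have "fst p \<le> 1" "fst (f p) \<le> 1"
      using p matchingD(1)[OF f p] by (cases p; cases "f p"; auto)+
    ultimately show "q \<in> endpoints (?R `` {skip1 p})"
      using connected_refl[OF skip_pt[OF p]] conn[OF p] by (auto simp: endpoints_skip1)
  qed
  have loop_ends: "endpoints (?R `` {(1, k)}) = {}" if "k \<in> N" for k
  proof -
    have False if q: "fst q \<le> 1" "((1, k), skip1 q) \<in> ?R" for q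
    proof -
      have "q \<in> tangle_points n" using q pt_skip connected_sub[of "glued_edges X Y"] by blast
      then show False using L[OF q(2)] arc N(2)[OF \<open>k \<in> N\<close>] by auto
    qed
    then show ?thesis by (auto simp: endpoints_skip1)
  qed
  have eq: "?R `` {x} = ?R `` {y}" if "(x, y) \<in> ?R" for x y
    using equiv_class_eq[OF equiv_connected that] .
  \<comment> \<open>A middle point outside \<open>N\<close> is connected to an outer point by
    \<open>mid\<close>, so the classes of the outer points and of \<open>N\<close> exhaust all
    components.\<close>
  have cases: "(\<exists>p\<in>tangle_points n. C = ?R `` {skip1 p}) \<or> (\<exists>k\<in>N. C = ?R `` {(1, k)})"
    if C: "C \<in> components (glued_edges X Y)" for C
  proof -
    obtain a k where ak: "(a, k) \<in> {0, 1, 2} \<times> {1..n}" "C = ?R `` {(a, k)}"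
      using C unfolding components_eq U by auto
    show ?thesis
    proof (cases "a = 1")
      case True
      show ?thesis
      proof (cases "k \<in> N")
        case False
        then have "k \<in> {1..n} - N" using ak by simp
        then obtain p where "p \<in> tangle_points n" "((1, k), skip1 p) \<in> ?R" using mid by blast
        then show ?thesis using eq ak(2) \<open>a = 1\<close> by metis
      next
        case True
        moreover have "C = ?R `` {(1, k)}" using ak(2) \<open>a = 1\<close> by simp
        ultimately show ?thesis by (intro disjI2 bexI[of _ k])
      qed
    next
      case False
      then have "(a, k) = skip1 (if a = 0 then 0 else 1, k)" using ak by (auto simp: skip1_def)
      moreover have "(if a = 0 then 0 else 1, k) \<in> tangle_points n" using ak by auto
      ultimately show ?thesis using ak by metis
    qed
  qed
  have comp: "?R `` {skip1 p} \<in> components (glued_edges X Y)" if "p \<in> tangle_points n" for p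
    unfolding components_def using skip_pt[OF that] by (rule quotientI)
  show "tangle_concat X Y = tangle_of n f"
  proof (intro equalityI subsetI)
    fix e assume "e \<in> tangle_concat X Y"
    then obtain C where "C \<in> components (glued_edges X Y)" "e = endpoints C" "e \<noteq> {}"
      by (auto simp: tangle_concat_def glued_components_eq)
    then obtain p where "p \<in> tangle_points n" "e = {p, f p}"
      using cases[of C] arc_ends loop_ends by metis
    then show "e \<in> tangle_of n f" unfolding tangle_of_def by simp
  next
    fix e assume "e \<in> tangle_of n f"
    then obtain p where p: "p \<in> tangle_points n" "e = {p, f p}" unfolding tangle_of_def by blast
    then have "e = endpoints (?R `` {skip1 p})" using arc_ends by simp
    moreover have "endpoints (?R `` {skip1 p}) \<noteq> {}" using arc_ends[OF p(1)] by simp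
    ultimately show "e \<in> tangle_concat X Y"
      using comp[OF p(1)] unfolding tangle_concat_def glued_components_eq by blast
  qed
  have "{C \<in> components (glued_edges X Y). endpoints C = {}} = (\<lambda>k. ?R `` {(1, k)}) ` N"
  proof (intro equalityI subsetI)
    fix C assume "C \<in> {C \<in> components (glued_edges X Y). endpoints C = {}}"
    then obtain k where "k \<in> N" "C = ?R `` {(1, k)}" using cases[of C] arc_ends by blast
    then show "C \<in> (\<lambda>k. ?R `` {(1, k)}) ` N" by simp
  next
    fix C assume "C \<in> (\<lambda>k. ?R `` {(1, k)}) ` N"
    then obtain k where k: "k \<in> N" "C = ?R `` {(1, k)}" by blast
    moreover have "(1, k) \<in> \<Union>(glued_edges X Y)" unfolding U using k N(1) by auto
    then have "?R `` {(1, k)} \<in> components (glued_edges X Y)" unfolding components_def by (rule quotientI)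
    ultimately show "C \<in> {C \<in> components (glued_edges X Y). endpoints C = {}}"
      using loop_ends[OF k(1)] by simp
  qed
  \<comment> \<open>All positions in \<open>N\<close> are connected to each other and so contribute
    a single curve.\<close>
  moreover have "card ((\<lambda>k. ?R `` {(1, k)}) ` N) = (if N = {} then 0 else 1)"
  proof (cases "N = {}")
    case False
    then obtain k where k: "k \<in> N" by blast
    have "?R `` {(1, l)} = ?R `` {(1, k)}" if "l \<in> N" for l
      using eq[OF N(3)[OF that k]] .
    then have "(\<lambda>l. ?R `` {(1, l)}) ` N = (\<lambda>l. ?R `` {(1, k)}) ` N"
      by (rule image_cong[OF refl])
    then show ?thesis using False by (simp only: image_constant[OF k]) simp
  qed simp
  ultimately show "closed_curves X Y = (if N = {} then 0 else 1)"
    by (simp add: closed_curves_def glued_components_eq)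
qed

section \<open>Left multiplication by a generator as an operation on matchings\<close>

definition id_matching :: "nat \<times> nat \<Rightarrow> nat \<times> nat" where
  "id_matching = (\<lambda>(a, k). (1 - a, k))"

definition on_top :: "(nat \<Rightarrow> nat) \<Rightarrow> nat \<times> nat \<Rightarrow> nat \<times> nat" where
  "on_top \<sigma> = (\<lambda>(a, k). if a = 0 then (0, \<sigma> k) else (a, k))"

text \<open>Conjugation by \<open>\<sigma>\<close> on the top points, for involutions \<open>\<sigma>\<close> only.\<close>

definition permute_top :: "(nat \<Rightarrow> nat) \<Rightarrow> (nat \<times> nat \<Rightarrow> nat \<times> nat) \<Rightarrow> nat \<times> nat \<Rightarrow> nat \<times> nat" where
  "permute_top \<sigma> f = on_top \<sigma> \<circ> f \<circ> on_top \<sigma>"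

text \<open>The formula also covers the gluing that closes a curve: for a matching in which
  \<open>(0, k)\<close> and \<open>(0, l)\<close> are already partners, the last two updates repeat
  the first two and the result is \<open>f\<close> itself.\<close>

definition cup :: "nat \<Rightarrow> nat \<Rightarrow> (nat \<times> nat \<Rightarrow> nat \<times> nat) \<Rightarrow> nat \<times> nat \<Rightarrow> nat \<times> nat" where
  "cup k l f = f((0, k) := (0, l), (0, l) := (0, k), f (0, k) := f (0, l), f (0, l) := f (0, k))"

text \<open>The common form of \<open>id_tangle\<close> and \<open>v_tangle\<close>, obtained from
  the identity and from an adjacent transposition.\<close>

definition permutation_tangle :: "nat \<Rightarrow> (nat \<Rightarrow> nat) \<Rightarrow> tangle" where
  "permutation_tangle n \<sigma> = (\<lambda>k. {(0, \<sigma> k), (1, k)}) ` {1..n}"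

lemma matching_id: "matching n id_matching"
  by (auto simp: matching_def id_matching_def le_Suc_eq)

lemma on_top_simps [simp]: "on_top \<sigma> (0, k) = (0, \<sigma> k)" "on_top \<sigma> (Suc a, k) = (Suc a, k)"
  by (auto simp: on_top_def)

lemma on_top_points: "(\<And>k. k \<in> {1..n} \<Longrightarrow> \<sigma> k \<in> {1..n}) \<Longrightarrow> p \<in> tangle_points n \<Longrightarrow> on_top \<sigma> p \<in> tangle_points n"
  by (cases p) (auto simp: on_top_def)

lemma on_top_involution: "(\<And>k. \<sigma> (\<sigma> k) = k) \<Longrightarrow> on_top \<sigma> (on_top \<sigma> p) = p"
  by (cases p) (auto simp: on_top_def)

lemma matching_permute_top:
  assumes "matching n f" and \<sigma>: "\<And>k. k \<in> {1..n} \<Longrightarrow> \<sigma> k \<in> {1..n}" "\<And>k. \<sigma> (\<sigma> k) = k"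
  shows "matching n (permute_top \<sigma> f)"
  unfolding matching_def
proof
  fix p assume p: "p \<in> tangle_points n"
  have q: "on_top \<sigma> p \<in> tangle_points n" using on_top_points[OF \<sigma>(1) p] .
  have T: "on_top \<sigma> (on_top \<sigma> x) = x" for x using on_top_involution[of \<sigma>, OF \<sigma>(2)] .
  have "on_top \<sigma> (f (on_top \<sigma> p)) \<in> tangle_points n" using on_top_points[OF \<sigma>(1) matchingD(1)[OF assms(1) q]] .
  moreover have "on_top \<sigma> (f (on_top \<sigma> p)) \<noteq> p" using matchingD(2)[OF assms(1) q] T by metis
  ultimately show "permute_top \<sigma> f p \<in> tangle_points n \<and> permute_top \<sigma> f p \<noteq> p \<and>
      permute_top \<sigma> f (permute_top \<sigma> f p) = p"
    using matchingD(3)[OF assms(1) q] by (simp add: permute_top_def T)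
qed

lemma Union_glued_edges_eq:
  assumes "\<Union>X = tangle_points n" "\<Union>Y = tangle_points n"
  shows "\<Union>(glued_edges X Y) = {0, 1, 2} \<times> {1..n}"
proof -
  have "\<Union>(glued_edges X Y) = tangle_points n \<union> shift ` tangle_points n"
    unfolding glued_edges_def Union_Un_distrib image_Union[symmetric] assms ..
  also have "\<dots> = {0, 1, 2} \<times> {1..n}"
  proof -
    have "shift ` tangle_points n = {1, 2} \<times> {1..n}"
      unfolding tangle_points_def apfst_def map_prod_surj_on by (auto simp: image_iff)
    then show ?thesis by (auto simp: tangle_points_def)
  qed
  finally show ?thesis .
qed

lemma connected_trans:
  "(x, y) \<in> (edge_rel H)\<^sup>+ \<Longrightarrow> (y, z) \<in> (edge_rel H)\<^sup>+ \<Longrightarrow> (x, z) \<in> (edge_rel H)\<^sup>+"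
  by (rule trancl_trans)

lemma connected_sym: "(x, y) \<in> (edge_rel H)\<^sup>+ \<Longrightarrow> (y, x) \<in> (edge_rel H)\<^sup>+"
  using sym_connected by (rule symD)

lemma glued_edges_left: "e \<in> X \<Longrightarrow> e \<in> glued_edges X Y"
  by (simp add: glued_edges_def)

lemma connected_shift_arc:
  "p \<in> tangle_points n \<Longrightarrow> (shift p, shift (f p)) \<in> (edge_rel (glued_edges X (tangle_of n f)))\<^sup>+"
  by (rule edge_connected[of "shift ` {p, f p}"])
    (auto simp: glued_edges_def tangle_of_def simp del: image_insert intro!: imageI)

text \<open>Vertical strands only rename the top points of the second tangle: the middle position
  \<open>k\<close> hangs on the top point \<open>(0, \<sigma> k)\<close>. Every middle point
  therefore lies on an arc, and no curve closes.\<close>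

lemma permutation_concat:
  assumes f: "matching n f" and \<sigma>: "\<And>k. k \<in> {1..n} \<Longrightarrow> \<sigma> k \<in> {1..n}" "\<And>k. \<sigma> (\<sigma> k) = k"
  shows "tangle_concat (permutation_tangle n \<sigma>) (tangle_of n f) = tangle_of n (permute_top \<sigma> f)"
    and "closed_curves (permutation_tangle n \<sigma>) (tangle_of n f) = 0"
proof -
  let ?X = "permutation_tangle n \<sigma>" and ?Y = "tangle_of n f" and ?T = "on_top \<sigma>"
  let ?R = "(edge_rel (glued_edges ?X ?Y))\<^sup>+"
  let ?f = "permute_top \<sigma> f"
  \<comment> \<open>A middle point takes the label of the top point it hangs on; points of layer 2
    are bottom points of the result and are renamed to layer 1.\<close>
  define L :: "nat \<times> nat \<Rightarrow> (nat \<times> nat) set" where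
    "L = (\<lambda>(a, k). let q = (if a = 0 then (0, k) else if a = 1 then (0, \<sigma> k) else (1, k)) in {q, ?f q})"
  have L_shift: "L (shift p) = {?T p, ?T (f p)}" if "p \<in> tangle_points n" for p
    using that by (cases p) (auto simp: L_def Let_def permute_top_def \<sigma>(2) on_top_def le_Suc_eq)
  have "\<Union>?X = tangle_points n"
  proof -
    have "(0, k) \<in> \<Union>?X" if "1 \<le> k" "k \<le> n" for k
      using that \<sigma>[of k] unfolding permutation_tangle_def by (auto intro!: bexI[of _ "\<sigma> k"])
    then show ?thesis using \<sigma>(1) by (auto simp: permutation_tangle_def tangle_points_def)
  qed
  then have U: "\<Union>(glued_edges ?X ?Y) = {0, 1, 2} \<times> {1..n}"
    using Union_glued_edges_eq Union_tangle_of[OF f] by blast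
  have f': "matching n ?f" using matching_permute_top[OF f \<sigma>] .
  have lab: "L x = L y" if "e \<in> glued_edges ?X ?Y" "x \<in> e" "y \<in> e" for e x y
  proof -
    have "e \<in> ?X \<or> (\<exists>p\<in>tangle_points n. e = {shift p, shift (f p)})"
      using that(1) by (auto simp: glued_edges_def tangle_of_def)
    then show ?thesis
    proof
      assume "e \<in> ?X"
      then show ?thesis using that by (auto simp: permutation_tangle_def L_def Let_def)
    next
      assume "\<exists>p\<in>tangle_points n. e = {shift p, shift (f p)}"
      then obtain p where p: "p \<in> tangle_points n" "e = {shift p, shift (f p)}" by blast
      then show ?thesis
        using that L_shift[OF p(1)] L_shift[OF matchingD(1)[OF f p(1)]] matchingD(3)[OF f p(1)] by auto
    qed
  qed
  have arc: "L (skip1 p) = {p, ?f p}" if "p \<in> tangle_points n" for p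
    using that by (cases p) (auto simp: L_def Let_def skip1_def le_Suc_eq)
  have down: "(skip1 p, shift (?T p)) \<in> ?R" if pt: "p \<in> tangle_points n" for p
  proof -
    obtain a k where [simp]: "p = (a, k)" by force
    consider "a = 0" | "a = 1" using pt by force
    then show ?thesis
    proof cases
      case 1
      have "{(0, k), (1, \<sigma> k)} \<in> ?X"
        using that \<sigma>[of k] by (auto simp: permutation_tangle_def intro!: image_eqI[of _ _ "\<sigma> k"])
      then show ?thesis using 1 by (intro edge_connected[OF glued_edges_left]) (auto simp: skip1_def)
    next
      case 2
      then have "skip1 p = shift (?T p)" by (auto simp: skip1_def)
      moreover have "skip1 p \<in> \<Union>(glued_edges ?X ?Y)" unfolding U using 2 that by (auto simp: skip1_def)
      ultimately show ?thesis using connected_refl by metis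
    qed
  qed
  have conn: "(skip1 p, skip1 (?f p)) \<in> ?R" if p: "p \<in> tangle_points n" for p
  proof -
    have q: "?T p \<in> tangle_points n" using on_top_points \<sigma>(1) p by blast
    have "(skip1 p, shift (f (?T p))) \<in> ?R"
      using down[OF p] connected_shift_arc[OF q] by (rule connected_trans)
    moreover have "(skip1 (?f p), shift (?T (?f p))) \<in> ?R" by (rule down[OF matchingD(1)[OF f' p]])
    moreover have "?T (?f p) = f (?T p)" by (simp add: permute_top_def on_top_involution \<sigma>(2))
    ultimately show ?thesis by (metis connected_trans connected_sym)
  qed
  have mid: "\<exists>p\<in>tangle_points n. ((1, k), skip1 p) \<in> ?R" if "k \<in> {1..n} - ({} :: nat set)" for k
  proof -
    have "(0, \<sigma> k) \<in> tangle_points n" using \<sigma>(1)[of k] that by auto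
    moreover have "shift (?T (0, \<sigma> k)) = (1, k)" by (simp add: \<sigma>(2))
    ultimately show ?thesis using down connected_sym by metis
  qed
  show "tangle_concat ?X ?Y = tangle_of n ?f"
    by (rule concat_by_labels(1)[OF U f' lab arc conn mid, where N = "{}"]) auto
  show "closed_curves ?X ?Y = 0"
    using concat_by_labels(2)[OF U f' lab arc conn mid, where N = "{}"] by simp
qed

lemma cup_apply:
  assumes f: "matching n f" and kl: "(0, k) \<in> tangle_points n" "(0, l) \<in> tangle_points n" "k \<noteq> l"
  shows "cup k l f (0, k) = (0, l)" "cup k l f (0, l) = (0, k)"
    "f (0, k) \<noteq> (0, l) \<Longrightarrow> cup k l f (f (0, k)) = f (0, l)"
    "f (0, k) \<noteq> (0, l) \<Longrightarrow> cup k l f (f (0, l)) = f (0, k)"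
    "p \<notin> {(0, k), (0, l), f (0, k), f (0, l)} \<Longrightarrow> cup k l f p = f p"
    "f (0, k) = (0, l) \<Longrightarrow> cup k l f = f"
proof -
  note m = matchingD[OF f kl(1)] matchingD[OF f kl(2)]
  have neq: "f (0, k) \<noteq> f (0, l)" using m(3,6) kl(3) by (metis prod.inject)
  show "cup k l f (0, k) = (0, l)" "cup k l f (0, l) = (0, k)"
    using m neq kl(3) by (auto simp: cup_def)
  show "cup k l f (f (0, k)) = f (0, l)" "cup k l f (f (0, l)) = f (0, k)" if "f (0, k) \<noteq> (0, l)"
    using neq by (auto simp: cup_def)
  show "p \<notin> {(0, k), (0, l), f (0, k), f (0, l)} \<Longrightarrow> cup k l f p = f p"
    by (auto simp: cup_def)
  show "cup k l f = f" if "f (0, k) = (0, l)"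
  proof -
    have "f (0, l) = (0, k)" using m(3) that by simp
    then show ?thesis unfolding cup_def that using that kl(3) by (auto simp: fun_eq_iff)
  qed
qed

lemma matching_cup:
  assumes f: "matching n f" and kl: "(0, k) \<in> tangle_points n" "(0, l) \<in> tangle_points n" "k \<noteq> l"
  shows "matching n (cup k l f)"
proof (cases "f (0, k) = (0, l)")
  case True
  then show ?thesis using cup_apply(6)[OF assms] f by simp
next
  case False
  let ?g = "cup k l f"
  note a = cup_apply[OF assms]
  note m = matchingD[OF f kl(1)] matchingD[OF f kl(2)]
  have neq: "f (0, k) \<noteq> f (0, l)" "f (0, l) \<noteq> (0, k)" using m(3,6) kl(3) False by (metis prod.inject)+
  have "?g p \<in> tangle_points n \<and> ?g p \<noteq> p \<and> ?g (?g p) = p" if p: "p \<in> tangle_points n" for p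
  proof -
    consider "p = (0, k)" | "p = (0, l)" | "p = f (0, k)" | "p = f (0, l)"
      | "p \<notin> {(0, k), (0, l), f (0, k), f (0, l)}" by blast
    then show ?thesis
    proof cases
      case 5
      have "f p \<notin> {(0, k), (0, l), f (0, k), f (0, l)}"
        using 5 m(3,6) matchingD(3)[OF f p] by auto
      then show ?thesis using a(5)[OF 5] a(5) matchingD[OF f p] by simp
    qed (use a(1-4) False neq m kl in simp_all)
  qed
  then show ?thesis by (simp add: matching_def)
qed

lemma Union_E_tangle:
  assumes "1 \<le> i" "i < n"
  shows "\<Union>(E_tangle n i) = tangle_points n"
proof (intro equalityI subsetI)
  fix x assume "x \<in> \<Union>(E_tangle n i)"
  then show "x \<in> tangle_points n" using assms by (auto simp: E_tangle_def)
next
  fix x assume x: "x \<in> tangle_points n"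
  obtain a k where [simp]: "x = (a, k)" by force
  have a: "a = 0 \<or> a = 1" and k: "1 \<le> k" "k \<le> n" using x by auto
  show "x \<in> \<Union>(E_tangle n i)"
  proof (cases "k = i \<or> k = i + 1")
    case True
    then show ?thesis using a by (auto simp: E_tangle_def)
  next
    case False
    then have "{(0, k), (1, k)} \<in> E_tangle n i" using k by (auto simp: E_tangle_def)
    then show ?thesis using a by (intro UnionI[of "{(0, k), (1, k)}"]) auto
  qed
qed

text \<open>The lower arc of \<open>E_tangle n i\<close> ties together the middle positions
  \<open>i\<close> and \<open>Suc i\<close>. If \<open>f\<close> makes these two partners, the tie
  closes a curve; otherwise it joins the two arcs of \<open>f\<close> that start there, so that
  their far ends become partners.\<close>

lemma E_tangle_concat:
  assumes f: "matching n f" and i: "1 \<le> i" "i < n"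
  shows "tangle_concat (E_tangle n i) (tangle_of n f) = tangle_of n (cup i (Suc i) f)"
    and "closed_curves (E_tangle n i) (tangle_of n f) = (if f (0, i) = (0, Suc i) then 1 else 0)"
proof -
  let ?X = "E_tangle n i" and ?Y = "tangle_of n f"
  let ?R = "(edge_rel (glued_edges ?X ?Y))\<^sup>+"
  let ?a = "(0, i)" and ?b = "(0, Suc i)"
  let ?f = "cup i (Suc i) f"
  have ab: "?a \<in> tangle_points n" "?b \<in> tangle_points n" "i \<noteq> Suc i" using i by auto
  note c = cup_apply[OF f ab] and ma = matchingD[OF f ab(1)] and mb = matchingD[OF f ab(2)]
  have f': "matching n ?f" by (rule matching_cup[OF f ab])
  define N where "N = (if f ?a = ?b then {i, Suc i} else {})"
  \<comment> \<open>The two tied middle positions lie on the closed curve, with empty label, or on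
    the arc between the far ends \<open>f ?a\<close> and \<open>f ?b\<close>. Any other middle point
    shares the label of the top point above it.\<close>
  define L :: "nat \<times> nat \<Rightarrow> (nat \<times> nat) set" where
    "L = (\<lambda>(a, k). if a = 1 \<and> (k = i \<or> k = Suc i) then (if f ?a = ?b then {} else {f ?a, f ?b})
       else if a \<le> 1 then {(0, k), ?f (0, k)} else {(1, k), ?f (1, k)})"
  have L_shift: "L (shift p) = {p, ?f p}" if "p \<in> tangle_points n" "p \<noteq> ?a" "p \<noteq> ?b" for p
    using that by (cases p) (auto simp: L_def le_Suc_eq)
  have L_mid: "L (shift ?a) = (if f ?a = ?b then {} else {f ?a, f ?b})" "L (shift ?b) = L (shift ?a)"
    by (auto simp: L_def)
  have U: "\<Union>(glued_edges ?X ?Y) = {0, 1, 2} \<times> {1..n}"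
    using Union_glued_edges_eq[OF Union_E_tangle[OF i] Union_tangle_of[OF f]] .
  have L_arc: "L (shift p) = L (shift (f p))" if p: "p \<in> tangle_points n" for p
  proof (cases "f ?a = ?b")
    case True
    then have fb: "f ?b = ?a" using ma(3) by simp
    show ?thesis
    proof (cases "p = ?a \<or> p = ?b")
      case True
      then show ?thesis using \<open>f ?a = ?b\<close> fb L_mid by auto
    next
      case False
      then have "f p \<noteq> ?a" "f p \<noteq> ?b" using \<open>f ?a = ?b\<close> fb matchingD(3)[OF f p] by metis+
      then show ?thesis
        using False L_shift[OF p] L_shift[OF matchingD(1)[OF f p]] c(6)[OF True] matchingD(3)[OF f p]
        by (simp add: insert_commute)
    qed
  next
    case ne: False
    then have ne': "f ?b \<noteq> ?a" using mb(3) by metis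
    have La: "L (shift (f ?a)) = {f ?a, f ?b}" "L (shift (f ?b)) = {f ?a, f ?b}"
      using L_shift[OF ma(1)] L_shift[OF mb(1)] ne ne' ma(2) mb(2) c(3,4) by (simp_all add: insert_commute)
    consider "p = ?a" | "p = ?b" | "p = f ?a" | "p = f ?b" | "p \<notin> {?a, ?b, f ?a, f ?b}" by blast
    then show ?thesis
    proof cases
      case 5
      have 6: "f p \<notin> {?a, ?b, f ?a, f ?b}"
        using 5 ma(3) mb(3) matchingD(3)[OF f p] by auto
      then show ?thesis
        using 5 L_shift[OF p] L_shift[OF matchingD(1)[OF f p]] c(5)[OF 5] c(5)[OF 6] matchingD(3)[OF f p]
        by (simp add: insert_commute)
    qed (use La L_mid ne ma(3) mb(3) in simp_all)
  qed
  have lab: "L x = L y" if "e \<in> glued_edges ?X ?Y" "x \<in> e" "y \<in> e" for e x y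
  proof -
    have "e \<in> ?X \<or> (\<exists>p\<in>tangle_points n. e = {shift p, shift (f p)})"
      using that(1) by (auto simp: glued_edges_def tangle_of_def)
    then show ?thesis
    proof
      assume "e \<in> ?X"
      then consider "e = {?a, ?b}" | "e = {(1, i), (1, Suc i)}"
        | k where "e = {(0, k), (1, k)}" "k \<noteq> i" "k \<noteq> Suc i"
        unfolding E_tangle_def by auto
      then show ?thesis
      proof cases
        case 1
        have "L ?a = L ?b" using c(1,2) by (simp add: L_def insert_commute)
        then show ?thesis using that 1 by auto
      next
        case 2
        have "L (1, i) = L (1, Suc i)" using L_mid by simp
        then show ?thesis using that 2 by auto
      next
        case 3
        then have "L (0, k) = L (1, k)" by (simp add: L_def)
        then show ?thesis using that 3 by auto
      qed
    next
      assume "\<exists>p\<in>tangle_points n. e = {shift p, shift (f p)}"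
      then obtain p where p: "p \<in> tangle_points n" "e = {shift p, shift (f p)}" by blast
      then show ?thesis using that L_arc[OF p(1)] by auto
    qed
  qed
  have arc: "L (skip1 p) = {p, ?f p}" if "p \<in> tangle_points n" for p
    using that by (cases p) (auto simp: L_def skip1_def le_Suc_eq)
  have down: "(skip1 p, shift p) \<in> ?R" if pt: "p \<in> tangle_points n" "p \<noteq> ?a" "p \<noteq> ?b" for p
  proof -
    obtain x k where [simp]: "p = (x, k)" by force
    consider "x = 0" | "x = 1" using pt(1) by force
    then show ?thesis
    proof cases
      case 1
      have "{(0, k), (1, k)} \<in> ?X" using that 1 by (auto simp: E_tangle_def)
      then show ?thesis using 1 by (intro edge_connected[OF glued_edges_left]) (auto simp: skip1_def)
    next
      case 2
      then have "skip1 p = shift p" by (auto simp: skip1_def)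
      moreover have "skip1 p \<in> \<Union>(glued_edges ?X ?Y)" unfolding U using 2 that by (auto simp: skip1_def)
      ultimately show ?thesis using connected_refl by metis
    qed
  qed
  have top: "(?a, ?b) \<in> ?R"
    by (rule edge_connected[OF glued_edges_left, of "{?a, ?b}"]) (auto simp: E_tangle_def)
  have bot: "(shift ?a, shift ?b) \<in> ?R"
    by (rule edge_connected[OF glued_edges_left, of "{shift ?a, shift ?b}"]) (auto simp: E_tangle_def)
  have up: "(shift p, skip1 (f p)) \<in> ?R" if p: "p \<in> tangle_points n" "f p \<noteq> ?a" "f p \<noteq> ?b" for p
    using connected_shift_arc[OF p(1)] connected_sym[OF down[OF matchingD(1)[OF f p(1)] p(2,3)]]
    by (rule connected_trans)
  have conn: "(skip1 p, skip1 (?f p)) \<in> ?R" if p: "p \<in> tangle_points n" for p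
  proof -
    have skip: "skip1 ?a = ?a" "skip1 ?b = ?b" by (auto simp: skip1_def)
    have ends: "(skip1 ?a, skip1 ?b) \<in> ?R" "(skip1 ?b, skip1 ?a) \<in> ?R"
      using top connected_sym[OF top] skip by simp_all
    consider "p = ?a \<or> p = ?b" | "p \<noteq> ?a" "p \<noteq> ?b" "p = f ?a \<or> p = f ?b" | "p \<notin> {?a, ?b, f ?a, f ?b}" by blast
    then show ?thesis
    proof cases
      case 1
      then show ?thesis using ends c(1,2) by auto
    next
      case 2
      have ne: "f ?a \<noteq> ?b" using 2 ma(3) by auto
      then have ne': "f ?b \<noteq> ?a" using mb(3) by metis
      \<comment> \<open>From the far end \<open>f ?a\<close> back to the middle position
        \<open>i\<close>, along the lower arc to \<open>Suc i\<close>, and on to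
        \<open>f ?b\<close>.\<close>
      have "(skip1 (f ?a), skip1 (f ?b)) \<in> ?R"
        using connected_trans[OF connected_sym[OF up[OF ab(1) ma(2) ne]] connected_trans[OF bot up[OF ab(2) ne' mb(2)]]] .
      then show ?thesis using 2 c(3,4)[OF ne] connected_sym by auto
    next
      case 3
      have "f p \<noteq> ?a" "f p \<noteq> ?b" using 3 matchingD(3)[OF f p] by auto
      then show ?thesis using connected_trans[OF down up] p 3 c(5)[OF 3] by simp
    qed
  qed
  have mid: "\<exists>p\<in>tangle_points n. ((1, k), skip1 p) \<in> ?R" if k: "k \<in> {1..n} - N" for k
  proof (cases "k = i \<or> k = Suc i")
    case True
    then have ne: "f ?a \<noteq> ?b" using k by (auto simp: N_def)
    then have ne': "f ?b \<noteq> ?a" using mb(3) by metis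
    have "((1, i), skip1 (f ?a)) \<in> ?R" "((1, Suc i), skip1 (f ?b)) \<in> ?R"
      using up[OF ab(1) ma(2) ne] up[OF ab(2) ne' mb(2)] by simp_all
    then show ?thesis using True ma(1) mb(1) by metis
  next
    case False
    then have "(skip1 (0, k), shift (0, k)) \<in> ?R" using down[of "(0, k)"] k by auto
    then show ?thesis using k connected_sym by (intro bexI[of _ "(0, k)"]) auto
  qed
  have N: "N \<subseteq> {1..n}" "\<And>k. k \<in> N \<Longrightarrow> L (1, k) = {}"
    using i by (auto simp: N_def L_def split: if_splits)
  have N3: "((1, k), (1, l)) \<in> ?R" if "k \<in> N" "l \<in> N" for k l
  proof -
    have "((1, i), (1, i)) \<in> ?R" "((1, Suc i), (1, Suc i)) \<in> ?R"
      by (rule connected_refl; use i in \<open>simp add: U\<close>)+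
    moreover have "((1, i), (1, Suc i)) \<in> ?R" "((1, Suc i), (1, i)) \<in> ?R"
      using bot connected_sym[OF bot] by simp_all
    moreover have "k = i \<or> k = Suc i" "l = i \<or> l = Suc i" using that by (auto simp: N_def split: if_splits)
    ultimately show ?thesis by metis
  qed
  show "tangle_concat ?X ?Y = tangle_of n ?f"
    by (rule concat_by_labels(1)[OF U f' lab arc conn mid N N3])
  show "closed_curves ?X ?Y = (if f ?a = ?b then 1 else 0)"
    using concat_by_labels(2)[OF U f' lab arc conn mid N N3] by (simp add: N_def)
qed

section \<open>Presented algebras\<close>

text \<open>The coefficient is an argument of \<open>g\<close>, so the target needs no scalar
  action. \<open>sign_rep\<close> exploits this by evaluating polynomial coefficients at -1 to
  obtain integers.\<close>

definition extend :: "('b \<Rightarrow> 'r \<Rightarrow> 'c) \<Rightarrow> ('b \<Rightarrow>\<^sub>0 'r::zero) \<Rightarrow> 'c::comm_monoid_add" where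
  "extend g x = (\<Sum>w\<in>Poly_Mapping.keys x. g w (Poly_Mapping.lookup x w))"

lemma extend_zero [simp]: "extend g 0 = 0"
  by (simp add: extend_def)

lemma extend_single [simp]: "g w 0 = 0 \<Longrightarrow> extend g (Poly_Mapping.single w c) = g w c"
  by (simp add: extend_def)

lemma extend_add:
  assumes "\<And>w. g w 0 = 0" "\<And>w a b. g w (a + b) = g w a + g w b"
  shows "extend g (x + y) = extend g x + extend g y"
  unfolding extend_def lookup_add[symmetric]
  by (rule setsum_keys_plus_distrib) (use assms in auto)

lemma poly_mapping_sum_singles:
  "x = (\<Sum>k\<in>Poly_Mapping.keys x. Poly_Mapping.single k (Poly_Mapping.lookup x k))"
proof (rule poly_mapping_eqI)
  fix i
  have "(\<Sum>k\<in>Poly_Mapping.keys x. Poly_Mapping.lookup (Poly_Mapping.single k (Poly_Mapping.lookup x k)) i)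
      = (\<Sum>k\<in>Poly_Mapping.keys x. if k = i then Poly_Mapping.lookup x i else 0)"
    by (rule sum.cong) (auto simp: lookup_single when_def)
  then show "Poly_Mapping.lookup x i = Poly_Mapping.lookup
      (\<Sum>k\<in>Poly_Mapping.keys x. Poly_Mapping.single k (Poly_Mapping.lookup x k)) i"
    by (simp add: lookup_sum not_in_keys_iff_lookup_eq_zero)
qed

lemma poly_mapping_keys_induct [consumes 1, case_names zero single add]:
  fixes x :: "'b \<Rightarrow>\<^sub>0 'r::comm_monoid_add"
  assumes "Poly_Mapping.keys x \<subseteq> B" and "P 0"
    and single: "\<And>w c. w \<in> B \<Longrightarrow> P (Poly_Mapping.single w c)"
    and add: "\<And>x y. P x \<Longrightarrow> P y \<Longrightarrow> P (x + y)"
  shows "P x"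
proof -
  have "P (\<Sum>k\<in>K. Poly_Mapping.single k (Poly_Mapping.lookup x k))" if "finite K" "K \<subseteq> B" for K
    using that by (induction rule: finite_induct) (auto intro: assms)
  from this[OF finite_keys assms(1)] show ?thesis
    using poly_mapping_sum_singles[of x] by simp
qed

lemma lookup_scale [simp]: "Poly_Mapping.lookup (scale c x) k = c * Poly_Mapping.lookup x k"
  by (simp add: scale_def map.rep_eq when_def)

lemma scale_simps:
  "scale c (x + y) = scale c x + scale c y" "scale (c + d) x = scale c x + scale d x"
  "scale c (scale d x) = scale (c * d) x" "scale c 0 = 0" "scale 0 x = 0" "scale 1 x = x"
  "scale c (Poly_Mapping.single w d) = Poly_Mapping.single w (c * d)"
  by (rule poly_mapping_eqI; simp add: lookup_add lookup_single when_def algebra_simps)+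

lemma keys_scale: "Poly_Mapping.keys (scale c x) \<subseteq> Poly_Mapping.keys x"
proof
  fix k assume "k \<in> Poly_Mapping.keys (scale c x)"
  then show "k \<in> Poly_Mapping.keys x" by (auto simp: in_keys_iff)
qed

lemma based_algebra_mult:
  "x \<otimes>\<^bsub>based_algebra B \<mu> e\<^esub> y = extend (\<lambda>u a. extend (\<lambda>v b. scale (a * b) (\<mu> u v)) y) x"
  by (simp add: based_algebra_def extend_def)

lemma based_algebra_simps [simp]:
  "x \<in> carrier (based_algebra B \<mu> e) \<longleftrightarrow> Poly_Mapping.keys x \<subseteq> B"
  "\<one>\<^bsub>based_algebra B \<mu> e\<^esub> = Poly_Mapping.single e 1"
  "\<zero>\<^bsub>based_algebra B \<mu> e\<^esub> = 0"
  "x \<oplus>\<^bsub>based_algebra B \<mu> e\<^esub> y = x + y"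
  "c \<odot>\<^bsub>based_algebra B \<mu> e\<^esub> x = scale c x"
  by (simp_all add: based_algebra_def)

lemma extend_sum_left: "extend (\<lambda>u a. g u a + h u a) x = extend g x + extend h x"
  by (simp add: extend_def sum.distrib)

lemma extend_const_zero [simp]: "extend (\<lambda>u a. 0) x = 0"
  by (simp add: extend_def)

lemma based_algebra_mult_simps:
  fixes x y z :: "'b \<Rightarrow>\<^sub>0 'r::comm_ring_1"
  shows
    "0 \<otimes>\<^bsub>based_algebra B \<mu> e\<^esub> y = 0" "x \<otimes>\<^bsub>based_algebra B \<mu> e\<^esub> 0 = 0"
    "(x + y) \<otimes>\<^bsub>based_algebra B \<mu> e\<^esub> z = x \<otimes>\<^bsub>based_algebra B \<mu> e\<^esub> z + y \<otimes>\<^bsub>based_algebra B \<mu> e\<^esub> z"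
    "x \<otimes>\<^bsub>based_algebra B \<mu> e\<^esub> (y + z) = x \<otimes>\<^bsub>based_algebra B \<mu> e\<^esub> y + x \<otimes>\<^bsub>based_algebra B \<mu> e\<^esub> z"
    "Poly_Mapping.single u a \<otimes>\<^bsub>based_algebra B \<mu> e\<^esub> Poly_Mapping.single v b = scale (a * b) (\<mu> u v)"
proof -
  have add_r: "extend (\<lambda>v b. scale (a * b) (\<mu> u v)) (y + z) =
      extend (\<lambda>v b. scale (a * b) (\<mu> u v)) y + extend (\<lambda>v b. scale (a * b) (\<mu> u v)) z" for a u and y z :: "'b \<Rightarrow>\<^sub>0 'r"
    by (rule extend_add) (simp_all add: scale_simps distrib_left)
  show "x \<otimes>\<^bsub>based_algebra B \<mu> e\<^esub> (y + z) = x \<otimes>\<^bsub>based_algebra B \<mu> e\<^esub> y + x \<otimes>\<^bsub>based_algebra B \<mu> e\<^esub> z"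
    by (simp add: based_algebra_mult add_r extend_sum_left)
  show "(x + y) \<otimes>\<^bsub>based_algebra B \<mu> e\<^esub> z = x \<otimes>\<^bsub>based_algebra B \<mu> e\<^esub> z + y \<otimes>\<^bsub>based_algebra B \<mu> e\<^esub> z"
    unfolding based_algebra_mult
    by (rule extend_add) (simp_all add: scale_simps distrib_right extend_sum_left)
qed (simp_all add: based_algebra_mult scale_simps)

lemma keys_add_sub:
  "Poly_Mapping.keys x \<subseteq> B \<Longrightarrow> Poly_Mapping.keys y \<subseteq> B \<Longrightarrow> Poly_Mapping.keys (x + y) \<subseteq> B"
  using Poly_Mapping.keys_add[of x y] by blast

lemma free_algebra_simps [simp]:
  "x \<in> carrier (free_algebra X) \<longleftrightarrow> Poly_Mapping.keys x \<subseteq> lists X"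
  "\<one>\<^bsub>free_algebra X\<^esub> = word []" "\<zero>\<^bsub>free_algebra X\<^esub> = 0"
  "x \<oplus>\<^bsub>free_algebra X\<^esub> y = x + y" "c \<odot>\<^bsub>free_algebra X\<^esub> x = scale c x"
  by (simp_all add: free_algebra_def)

lemma free_algebra_mult_simps:
  fixes x y z :: "'g list \<Rightarrow>\<^sub>0 'r::comm_ring_1"
  shows
    "0 \<otimes>\<^bsub>free_algebra X\<^esub> y = 0" "x \<otimes>\<^bsub>free_algebra X\<^esub> 0 = 0"
    "(x + y) \<otimes>\<^bsub>free_algebra X\<^esub> z = x \<otimes>\<^bsub>free_algebra X\<^esub> z + y \<otimes>\<^bsub>free_algebra X\<^esub> z"
    "x \<otimes>\<^bsub>free_algebra X\<^esub> (y + z) = x \<otimes>\<^bsub>free_algebra X\<^esub> y + x \<otimes>\<^bsub>free_algebra X\<^esub> z"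
    "Poly_Mapping.single u a \<otimes>\<^bsub>free_algebra X\<^esub> Poly_Mapping.single v b = Poly_Mapping.single (u @ v) (a * b)"
  by (simp_all add: free_algebra_def based_algebra_mult_simps scale_simps)

text \<open>Reduces \<open>free_algebra_assoc\<close>, \<open>Phi_mult\<close> and
  \<open>sign_rep_mult\<close> to identities about words. Additivity suffices because the singles
  carry arbitrary coefficients.\<close>

lemma poly_mapping_biadditive_eqI:
  fixes P Q :: "('a \<Rightarrow>\<^sub>0 'r::comm_monoid_add) \<Rightarrow> ('b \<Rightarrow>\<^sub>0 's::comm_monoid_add) \<Rightarrow> 'c::ab_group_add"
  assumes x: "Poly_Mapping.keys x \<subseteq> A" and y: "Poly_Mapping.keys y \<subseteq> B"
    and P: "\<And>x y z. P (x + y) z = P x z + P y z" "\<And>x y z. P x (y + z) = P x y + P x z"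
    and Q: "\<And>x y z. Q (x + y) z = Q x z + Q y z" "\<And>x y z. Q x (y + z) = Q x y + Q x z"
    and eq: "\<And>u v a b. u \<in> A \<Longrightarrow> v \<in> B \<Longrightarrow>
      P (Poly_Mapping.single u a) (Poly_Mapping.single v b) = Q (Poly_Mapping.single u a) (Poly_Mapping.single v b)"
  shows "P x y = Q x y"
proof -
  have P0: "P 0 z = 0" "P x 0 = 0" for x z using P(1)[of 0 0 z] P(2)[of x 0 0] by simp_all
  have Q0: "Q 0 z = 0" "Q x 0 = 0" for x z using Q(1)[of 0 0 z] Q(2)[of x 0 0] by simp_all
  have single: "P (Poly_Mapping.single u a) y = Q (Poly_Mapping.single u a) y" if "u \<in> A" for u a
    using y by (induction y rule: poly_mapping_keys_induct) (simp_all add: P Q P0 Q0 eq that)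
  show ?thesis
    using x by (induction x rule: poly_mapping_keys_induct) (simp_all add: P Q P0 Q0 single)
qed

lemma free_algebra_mult_closed:
  assumes "Poly_Mapping.keys x \<subseteq> lists X" "Poly_Mapping.keys y \<subseteq> lists X"
  shows "Poly_Mapping.keys (x \<otimes>\<^bsub>free_algebra X\<^esub> y) \<subseteq> lists X"
proof -
  have single: "Poly_Mapping.keys (Poly_Mapping.single u a \<otimes>\<^bsub>free_algebra X\<^esub> y) \<subseteq> lists X" if "u \<in> lists X" for u a
    using assms(2)
    by (induction y rule: poly_mapping_keys_induct) (use that in \<open>auto simp: free_algebra_mult_simps keys_add_sub\<close>)
  show ?thesis
    using assms(1)
    by (induction x rule: poly_mapping_keys_induct) (simp_all add: free_algebra_mult_simps keys_add_sub single)
qed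

lemma free_algebra_assoc:
  fixes x y z :: "'g list \<Rightarrow>\<^sub>0 'r::comm_ring_1"
  shows "x \<otimes>\<^bsub>free_algebra X\<^esub> y \<otimes>\<^bsub>free_algebra X\<^esub> z = x \<otimes>\<^bsub>free_algebra X\<^esub> (y \<otimes>\<^bsub>free_algebra X\<^esub> z)"
  using subset_UNIV[of "Poly_Mapping.keys z"]
proof (induction z rule: poly_mapping_keys_induct)
  case (single w c)
  show ?case
    by (rule poly_mapping_biadditive_eqI[OF subset_UNIV subset_UNIV])
      (simp_all add: free_algebra_mult_simps mult_ac)
qed (simp_all add: free_algebra_mult_simps)

lemma ring_free_algebra: "ring (free_algebra X :: ('r::comm_ring_1, 'g list \<Rightarrow>\<^sub>0 'r) module)" (is "ring ?F")
proof (rule ringI)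
  show "abelian_group ?F"
  proof (rule abelian_groupI)
    fix x assume "x \<in> carrier ?F"
    then show "\<exists>y\<in>carrier ?F. y \<oplus>\<^bsub>?F\<^esub> x = \<zero>\<^bsub>?F\<^esub>" by (intro bexI[of _ "- x"]) simp_all
  qed (simp_all add: keys_add_sub add_ac)
  have one: "word [] \<otimes>\<^bsub>?F\<^esub> x = x" "x \<otimes>\<^bsub>?F\<^esub> word [] = x" for x
    using subset_UNIV[of "Poly_Mapping.keys x"]
    by (induction x rule: poly_mapping_keys_induct) (simp_all add: free_algebra_mult_simps)
  show "monoid ?F"
    by (rule monoidI) (simp_all add: free_algebra_mult_closed free_algebra_assoc one)
qed (simp_all add: free_algebra_mult_simps)

section \<open>The quotient by the relation ideal and the homomorphisms out of it\<close>

context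
  fixes X :: "'g set" and S :: "(('g list \<Rightarrow>\<^sub>0 'r) \<times> ('g list \<Rightarrow>\<^sub>0 'r::comm_ring_1)) set"
  assumes S: "S \<subseteq> carrier (free_algebra X) \<times> carrier (free_algebra X)"
begin

abbreviation (input) "F \<equiv> free_algebra X :: ('r, 'g list \<Rightarrow>\<^sub>0 'r) module"
abbreviation (input) "J \<equiv> relation_ideal X S"
abbreviation (input) "cls x \<equiv> J +>\<^bsub>F\<^esub> x"

lemma ideal_relation_ideal: "ideal J F"
  unfolding relation_ideal_def
proof (rule ring.genideal_ideal[OF ring_free_algebra])
  have "x - y \<in> carrier F" if "(x, y) \<in> S" for x y
  proof -
    have "x \<in> carrier F" "y \<in> carrier F" using S that by blast+
    then show ?thesis using Poly_Mapping.keys_diff[of x y] by auto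
  qed
  then show "{x - y | x y. (x, y) \<in> S} \<subseteq> carrier F" by blast
qed

text \<open>The zero set of \<open>h\<close> is an ideal containing the generators of
  \<open>J\<close>. The target is an additive group with an operation \<open>m\<close> that zero
  absorbs, so the lemma applies to \<open>Phi n\<close> with the product of \<open>VTL n\<close> as
  well as to \<open>sign_rep\<close> with the product of integers.\<close>

lemma relation_ideal_kernel:
  fixes h :: "('g list \<Rightarrow>\<^sub>0 'r) \<Rightarrow> 'c::ab_group_add"
  assumes add: "\<And>x y. h (x + y) = h x + h y"
    and mult: "\<And>x y. x \<in> carrier F \<Longrightarrow> y \<in> carrier F \<Longrightarrow> h (x \<otimes>\<^bsub>F\<^esub> y) = m (h x) (h y)"
    and m0: "\<And>c. m 0 c = 0" "\<And>c. m c 0 = 0"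
    and rel: "\<And>x y. (x, y) \<in> S \<Longrightarrow> h x = h y"
    and i: "i \<in> J"
  shows "h i = 0"
proof -
  interpret F: ring F by (rule ring_free_algebra)
  let ?K = "{x \<in> carrier F. h x = 0}"
  have h0: "h 0 = 0" using add[of 0 0] by simp
  have neg: "h (- x) = - h x" for x using add[of x "- x"] h0 by (simp add: eq_neg_iff_add_eq_0 add.commute)
  have "ideal ?K F"
  proof (rule idealI[OF ring_free_algebra])
    show "subgroup ?K (add_monoid F)"
    proof
      show "?K \<subseteq> carrier (add_monoid F)" by auto
      fix x y assume xy: "x \<in> ?K" "y \<in> ?K"
      show "x \<otimes>\<^bsub>add_monoid F\<^esub> y \<in> ?K" using xy by (simp add: add keys_add_sub)
    next
      show "\<one>\<^bsub>add_monoid F\<^esub> \<in> ?K" by (simp add: h0)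
    next
      fix x assume x: "x \<in> ?K"
      then have "\<ominus>\<^bsub>F\<^esub> x = - x" by (intro F.minus_equality) simp_all
      then show "inv\<^bsub>add_monoid F\<^esub> x \<in> ?K" using x by (simp add: a_inv_def neg)
    qed
    fix a x assume "a \<in> ?K" "x \<in> carrier F"
    then show "x \<otimes>\<^bsub>F\<^esub> a \<in> ?K" "a \<otimes>\<^bsub>F\<^esub> x \<in> ?K"
      using mult[of x a] mult[of a x] by (simp_all add: m0 free_algebra_mult_closed)
  qed
  moreover have "{x - y | x y. (x, y) \<in> S} \<subseteq> ?K"
  proof
    fix d assume "d \<in> {x - y | x y. (x, y) \<in> S}"
    then obtain x y where d: "d = x - y" "(x, y) \<in> S" by blast
    then have "x \<in> carrier F" "y \<in> carrier F" using S by blast+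
    then have "d \<in> carrier F" using d Poly_Mapping.keys_diff[of x y] by auto
    moreover have "h d = 0" using add[of x "- y"] rel[OF d(2)] d(1) by (simp add: neg)
    ultimately show "d \<in> ?K" by blast
  qed
  ultimately have "J \<subseteq> ?K" unfolding relation_ideal_def by (rule F.genideal_minimal)
  then show ?thesis using i by blast
qed

lemma mem_cls: "y \<in> cls x \<longleftrightarrow> y - x \<in> J"
proof -
  have "y \<in> cls x \<longleftrightarrow> (\<exists>i\<in>J. y = i + x)" by (auto simp: a_r_coset_def')
  then show ?thesis by (metis add_diff_cancel_right' diff_add_cancel)
qed

text \<open>A scalar acts as left multiplication by a constant multiple of the empty word, so a ring
  ideal is automatically a submodule.\<close>

lemma scale_relation_ideal: "i \<in> J \<Longrightarrow> scale c i \<in> J"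
proof -
  interpret ideal J F by (rule ideal_relation_ideal)
  assume i: "i \<in> J"
  have "Poly_Mapping.single [] c \<otimes>\<^bsub>F\<^esub> i \<in> J"
    by (rule I_l_closed[OF i]) simp
  moreover have "Poly_Mapping.single [] c \<otimes>\<^bsub>F\<^esub> x = scale c x" for x
    using subset_UNIV[of "Poly_Mapping.keys x"]
    by (induction x rule: poly_mapping_keys_induct) (simp_all add: free_algebra_mult_simps scale_simps)
  ultimately show ?thesis by simp
qed

lemma presented_algebra_simps:
  "carrier (presented_algebra X S) = {cls x | x. x \<in> carrier F}"
  "x \<in> carrier F \<Longrightarrow> y \<in> carrier F \<Longrightarrow> cls x \<otimes>\<^bsub>presented_algebra X S\<^esub> cls y = cls (x \<otimes>\<^bsub>F\<^esub> y)"
  "x \<in> carrier F \<Longrightarrow> y \<in> carrier F \<Longrightarrow> cls x \<oplus>\<^bsub>presented_algebra X S\<^esub> cls y = cls (x + y)"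
  "\<one>\<^bsub>presented_algebra X S\<^esub> = cls (word [])"
  "x \<in> carrier F \<Longrightarrow> c \<odot>\<^bsub>presented_algebra X S\<^esub> cls x = cls (scale c x)"
proof -
  interpret I: ideal J F by (rule ideal_relation_ideal)
  show "carrier (presented_algebra X S) = {cls x | x. x \<in> carrier F}"
    unfolding presented_algebra_def Let_def FactRing_def by (auto simp: A_RCOSETS_def')
  assume x: "x \<in> carrier F"
  \<comment> \<open>All cosets in the union that defines the scalar multiple coincide; the union is
    then that coset because its index set is nonempty.\<close>
  have *: "cls (scale c y) = cls (scale c x)" if "y \<in> cls x" for y
  proof (rule I.a_repr_independence'[symmetric])
    have "scale c y - scale c x = scale c (y - x)"
      by (rule poly_mapping_eqI) (simp add: lookup_minus right_diff_distrib)
    then show "scale c y \<in> cls (scale c x)"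
      using that scale_relation_ideal[of "y - x" c] by (simp add: mem_cls)
    show "scale c x \<in> carrier F" using x keys_scale[of c x] by auto
  qed
  have "cls x \<noteq> {}" using I.a_rcos_self[OF x] by blast
  then have "(\<Union>y\<in>cls x. cls (scale c y)) = cls (scale c x)" using * by (rule SUP_eq_const)
  then show "c \<odot>\<^bsub>presented_algebra X S\<^esub> cls x = cls (scale c x)"
    by (simp add: presented_algebra_def Let_def)
next
  interpret I: ideal J F by (rule ideal_relation_ideal)
  assume xy: "x \<in> carrier F" "y \<in> carrier F"
  show "cls x \<otimes>\<^bsub>presented_algebra X S\<^esub> cls y = cls (x \<otimes>\<^bsub>F\<^esub> y)"
    using I.rcoset_mult_add[OF xy] by (simp add: presented_algebra_def Let_def FactRing_def)
  show "cls x \<oplus>\<^bsub>presented_algebra X S\<^esub> cls y = cls (x + y)"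
    using I.a_rcos_sum[OF xy] by (simp add: presented_algebra_def Let_def FactRing_def)
next
  show "\<one>\<^bsub>presented_algebra X S\<^esub> = cls (word [])"
    by (simp add: presented_algebra_def Let_def FactRing_def)
qed

lemma induced_hom:
  fixes h :: "('g list \<Rightarrow>\<^sub>0 'r) \<Rightarrow> 'c::ab_group_add" and A :: "('r, 'c, 'm) module_scheme"
  assumes add: "\<And>x y. h (x + y) = h x + h y" and "add A = (+)"
    and closed: "\<And>x. x \<in> carrier F \<Longrightarrow> h x \<in> carrier A"
    and mult: "\<And>x y. x \<in> carrier F \<Longrightarrow> y \<in> carrier F \<Longrightarrow> h (x \<otimes>\<^bsub>F\<^esub> y) = h x \<otimes>\<^bsub>A\<^esub> h y"
    and m0: "\<And>c. 0 \<otimes>\<^bsub>A\<^esub> c = 0" "\<And>c. c \<otimes>\<^bsub>A\<^esub> 0 = 0"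
    and one: "h (word []) = \<one>\<^bsub>A\<^esub>"
    and scale: "\<And>c x. x \<in> carrier F \<Longrightarrow> h (scale c x) = c \<odot>\<^bsub>A\<^esub> h x"
    and rel: "\<And>x y. (x, y) \<in> S \<Longrightarrow> h x = h y"
  obtains \<phi> where "\<phi> \<in> alg_hom (presented_algebra X S) A" "\<phi> \<in> extensional (carrier (presented_algebra X S))"
    "\<And>x. x \<in> carrier F \<Longrightarrow> \<phi> (cls x) = h x"
proof -
  interpret I: ideal J F by (rule ideal_relation_ideal)
  \<comment> \<open>Any representative gives the same value since \<open>h\<close> vanishes on
    \<open>J\<close>. The restriction makes the map extensional.\<close>
  define \<phi> where "\<phi> = restrict (\<lambda>C. h (SOME x. x \<in> C)) (carrier (presented_algebra X S))"
  have J0: "h i = 0" if "i \<in> J" for i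
    using relation_ideal_kernel[of h "mult A", OF add mult m0 rel that] .
  have \<phi>: "\<phi> (cls x) = h x" if x: "x \<in> carrier F" for x
  proof -
    let ?y = "SOME y. y \<in> cls x"
    have "?y \<in> cls x" using I.a_rcos_self[OF x] by (rule someI)
    then have "?y - x \<in> J" by (simp add: mem_cls)
    then have "h ?y = h x" using add[of "?y - x" x] J0 by simp
    moreover have "cls x \<in> carrier (presented_algebra X S)" using x presented_algebra_simps(1) by blast
    ultimately show ?thesis by (simp add: \<phi>_def)
  qed
  have "\<phi> \<in> alg_hom (presented_algebra X S) A"
    unfolding alg_hom_def
  proof (intro CollectI conjI ring_hom_memI ballI allI)
    fix C assume "C \<in> carrier (presented_algebra X S)"
    then obtain x where x: "x \<in> carrier F" "C = cls x" using presented_algebra_simps(1) by blast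
    then show "\<phi> C \<in> carrier A" using \<phi> closed by simp
    have "scale c x \<in> carrier F" for c using x keys_scale[of c x] by auto
    then show "\<phi> (c \<odot>\<^bsub>presented_algebra X S\<^esub> C) = c \<odot>\<^bsub>A\<^esub> \<phi> C" for c
      using x \<phi> scale presented_algebra_simps(5) by simp
    fix D assume "D \<in> carrier (presented_algebra X S)"
    then obtain y where y: "y \<in> carrier F" "D = cls y" using presented_algebra_simps(1) by blast
    have "x \<otimes>\<^bsub>F\<^esub> y \<in> carrier F" "x + y \<in> carrier F"
      using x y by (simp_all add: free_algebra_mult_closed keys_add_sub)
    then show "\<phi> (C \<otimes>\<^bsub>presented_algebra X S\<^esub> D) = \<phi> C \<otimes>\<^bsub>A\<^esub> \<phi> D"
      "\<phi> (C \<oplus>\<^bsub>presented_algebra X S\<^esub> D) = \<phi> C \<oplus>\<^bsub>A\<^esub> \<phi> D"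
      using x y \<phi> mult add assms(2) presented_algebra_simps(2,3) by simp_all
  next
    show "\<phi> \<one>\<^bsub>presented_algebra X S\<^esub> = \<one>\<^bsub>A\<^esub>"
      using \<phi> one presented_algebra_simps(4) by simp
  qed
  moreover have "\<phi> \<in> extensional (carrier (presented_algebra X S))" by (simp add: \<phi>_def)
  ultimately show ?thesis using \<phi> that by blast
qed

text \<open>Cosets of words are products of cosets of generators, and they span. An arbitrary
  homomorphism with the right values on generators can thus be replaced by the explicit
  \<open>h\<close>, which gives uniqueness and lets the final arguments treat every such
  map.\<close>

lemma hom_determined:
  fixes h :: "('g list \<Rightarrow>\<^sub>0 'r) \<Rightarrow> 'c::ab_group_add" and A :: "('r, 'c, 'm) module_scheme"
  assumes \<phi>: "\<phi> \<in> alg_hom (presented_algebra X S) A" and add: "add A = (+)"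
    and h_add: "\<And>x y. h (x + y) = h x + h y"
    and h_mult: "\<And>x y. x \<in> carrier F \<Longrightarrow> y \<in> carrier F \<Longrightarrow> h (x \<otimes>\<^bsub>F\<^esub> y) = h x \<otimes>\<^bsub>A\<^esub> h y"
    and h_one: "h (word []) = \<one>\<^bsub>A\<^esub>"
    and h_scale: "\<And>c x. x \<in> carrier F \<Longrightarrow> h (scale c x) = c \<odot>\<^bsub>A\<^esub> h x"
    and gens: "\<And>g. g \<in> X \<Longrightarrow> \<phi> (presented_gen X S g) = h (word [g])"
    and x: "x \<in> carrier F"
  shows "\<phi> (cls x) = h x"
proof -
  have car: "cls x \<in> carrier (presented_algebra X S)" if "x \<in> carrier F" for x
    using that presented_algebra_simps(1) by blast
  have hom: "\<phi> \<in> ring_hom (presented_algebra X S) A" and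
    smult: "\<And>c C. C \<in> carrier (presented_algebra X S) \<Longrightarrow> \<phi> (c \<odot>\<^bsub>presented_algebra X S\<^esub> C) = c \<odot>\<^bsub>A\<^esub> \<phi> C"
    using \<phi> by (auto simp: alg_hom_def)
  have words: "\<phi> (cls (word w)) = h (word w)" if "w \<in> lists X" for w
    using that
  proof (induction w)
    case Nil
    then show ?case using ring_hom_one[OF hom] h_one presented_algebra_simps(4) by simp
  next
    case (Cons g w)
    have gw: "word [g] \<in> carrier F" "word w \<in> carrier F" using Cons by auto
    have eq: "word (g # w) = word [g] \<otimes>\<^bsub>F\<^esub> word w" by (simp add: free_algebra_mult_simps)
    have "\<phi> (cls (word (g # w))) = \<phi> (cls (word [g])) \<otimes>\<^bsub>A\<^esub> \<phi> (cls (word w))"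
      unfolding eq presented_algebra_simps(2)[OF gw, symmetric]
      by (rule ring_hom_mult[OF hom car[OF gw(1)] car[OF gw(2)]])
    then show ?case
      using Cons gens[of g] h_mult[OF gw] unfolding eq by (simp add: presented_gen_def)
  qed
  have singles: "\<phi> (cls (Poly_Mapping.single w c)) = h (Poly_Mapping.single w c)" if "w \<in> lists X" for w c
  proof -
    have w: "word w \<in> carrier F" using that by simp
    have eq: "Poly_Mapping.single w c = scale c (word w)" by (simp add: scale_simps)
    show ?thesis
      unfolding eq presented_algebra_simps(5)[OF w, symmetric] smult[OF car[OF w]] h_scale[OF w] words[OF that] ..
  qed
  have sum: "\<phi> (cls (x + y)) = \<phi> (cls x) + \<phi> (cls y)" if "x \<in> carrier F" "y \<in> carrier F" for x y
    using ring_hom_add[OF hom car[OF that(1)] car[OF that(2)]] presented_algebra_simps(3)[OF that] add by simp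
  have zero: "\<phi> (cls 0) = h 0"
    using sum[of 0 0] h_add[of 0 0] by simp
  have "Poly_Mapping.keys x \<subseteq> lists X" using x by simp
  \<comment> \<open>The support condition joins the claim because the induction rule does not hand
    it to the summands, and \<open>sum\<close> asks for it.\<close>
  then have "Poly_Mapping.keys x \<subseteq> lists X \<and> \<phi> (cls x) = h x"
    by (induction x rule: poly_mapping_keys_induct)
      (use zero singles sum h_add in \<open>auto simp: keys_add_sub\<close>)
  then show ?thesis by blast
qed

end

section \<open>Words in the generators\<close>

lemma tangle_of_eqI:
  assumes "\<Union>E = tangle_points n" "\<And>e x. e \<in> E \<Longrightarrow> x \<in> e \<Longrightarrow> e = {x, f x}" "{} \<notin> E"
  shows "E = tangle_of n f"
proof (intro equalityI subsetI)
  fix e assume e: "e \<in> E"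
  then have "e \<noteq> {}" using assms(3) by blast
  then obtain x where x: "x \<in> e" by blast
  have "x \<in> tangle_points n" using UnionI[OF e x] assms(1) by simp
  then show "e \<in> tangle_of n f" using assms(2)[OF e x] by (simp add: tangle_of_def)
next
  fix e assume "e \<in> tangle_of n f"
  then obtain x where x: "x \<in> tangle_points n" "e = {x, f x}" unfolding tangle_of_def by blast
  then have "x \<in> \<Union>E" using assms(1) by simp
  then obtain d where "d \<in> E" "x \<in> d" by (rule UnionE)
  then show "e \<in> E" using assms(2)[of d x] x by simp
qed

lemma transpose_points: "1 \<le> k \<Longrightarrow> k \<le> n \<Longrightarrow> 1 \<le> l \<Longrightarrow> l \<le> n \<Longrightarrow> j \<in> {1..n} \<Longrightarrow> transpose k l j \<in> {1..n}"
  by (auto simp: transpose_def)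

lemma v_tangle_eq:
  assumes "1 \<le> i" "i < n"
  shows "v_tangle n i = permutation_tangle n (transpose i (Suc i))"
proof (intro equalityI subsetI)
  fix e assume "e \<in> v_tangle n i"
  then consider "e = {(0, i), (1, Suc i)}" | "e = {(0, Suc i), (1, i)}"
    | k where "e = {(0, k), (1, k)}" "k \<in> {1..n}" "k \<noteq> i" "k \<noteq> Suc i"
    unfolding v_tangle_def by auto
  then show "e \<in> permutation_tangle n (transpose i (Suc i))"
    unfolding permutation_tangle_def
  proof cases
    case 1
    then show "e \<in> (\<lambda>k. {(0, transpose i (Suc i) k), (1, k)}) ` {1..n}"
      using assms by (intro image_eqI[of _ _ "Suc i"]) auto
  next
    case 2
    then show "e \<in> (\<lambda>k. {(0, transpose i (Suc i) k), (1, k)}) ` {1..n}"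
      using assms by (intro image_eqI[of _ _ i]) auto
  next
    case 3
    then show "e \<in> (\<lambda>k. {(0, transpose i (Suc i) k), (1, k)}) ` {1..n}"
      by (intro image_eqI[of _ _ k]) auto
  qed
next
  fix e assume "e \<in> permutation_tangle n (transpose i (Suc i))"
  then obtain k where k: "k \<in> {1..n}" "e = {(0, transpose i (Suc i) k), (1, k)}"
    unfolding permutation_tangle_def by blast
  consider "k = i" | "k = Suc i" | "k \<noteq> i" "k \<noteq> Suc i" by blast
  then show "e \<in> v_tangle n i"
    using k by cases (auto simp: v_tangle_def)
qed

lemma permutation_tangle_eq:
  assumes \<sigma>: "\<And>k. k \<in> {1..n} \<Longrightarrow> \<sigma> k \<in> {1..n}" "\<And>k. \<sigma> (\<sigma> k) = k"
  shows "permutation_tangle n \<sigma> = tangle_of n (permute_top \<sigma> id_matching)"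
proof (rule tangle_of_eqI)
  show "\<Union>(permutation_tangle n \<sigma>) = tangle_points n"
  proof (intro equalityI subsetI)
    fix x assume "x \<in> \<Union>(permutation_tangle n \<sigma>)"
    then show "x \<in> tangle_points n" using \<sigma>(1) by (auto simp: permutation_tangle_def)
  next
    fix x assume x: "x \<in> tangle_points n"
    obtain a k where [simp]: "x = (a, k)" by force
    have "k \<in> {1..n}" using x by auto
    then have "{(0, \<sigma> k), (1, k)} \<in> permutation_tangle n \<sigma>" "{(0, \<sigma> (\<sigma> k)), (1, \<sigma> k)} \<in> permutation_tangle n \<sigma>"
      using \<sigma>(1) unfolding permutation_tangle_def by blast+
    moreover have "a = 0 \<or> a = 1" using x by auto
    ultimately show "x \<in> \<Union>(permutation_tangle n \<sigma>)" using \<sigma>(2) by auto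
  qed
  show "e = {x, permute_top \<sigma> id_matching x}" if "e \<in> permutation_tangle n \<sigma>" "x \<in> e" for e x
    using that by (auto simp: permutation_tangle_def permute_top_def id_matching_def \<sigma>(2))
  show "{} \<notin> permutation_tangle n \<sigma>" by (auto simp: permutation_tangle_def)
qed

lemma permute_top_id: "permute_top id f = f"
  by (auto simp: permute_top_def on_top_def fun_eq_iff split: prod.splits)

lemma id_tangle_eq: "id_tangle n = tangle_of n id_matching"
proof -
  have "id_tangle n = permutation_tangle n id" by (auto simp: id_tangle_def permutation_tangle_def)
  then show ?thesis using permutation_tangle_eq[of n id] by (simp add: permute_top_id)
qed

lemma E_tangle_eq:
  assumes "1 \<le> i" "i < n"
  shows "E_tangle n i = tangle_of n (cup i (Suc i) id_matching)"
proof (rule tangle_of_eqI)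
  show "\<Union>(E_tangle n i) = tangle_points n" by (rule Union_E_tangle[OF assms])
  show "e = {x, cup i (Suc i) id_matching x}" if "e \<in> E_tangle n i" "x \<in> e" for e x
  proof -
    have "e = {(0, i), (0, Suc i)} \<or> e = {(1, i), (1, Suc i)} \<or>
        (\<exists>k. e = {(0, k), (1, k)} \<and> k \<noteq> i \<and> k \<noteq> Suc i)"
      using that(1) unfolding E_tangle_def by auto
    then show ?thesis
      using that(2) by (elim disjE exE conjE) (auto simp: cup_def id_matching_def)
  qed
  show "{} \<notin> E_tangle n i" by (auto simp: E_tangle_def)
qed

section \<open>Words evaluated as matchings with a count of closed curves\<close>

fun gen_tangle :: "nat \<Rightarrow> vtl_gen \<Rightarrow> tangle" where
  "gen_tangle n (GE i) = E_tangle n i"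
| "gen_tangle n (GV i) = v_tangle n i"

fun gen_act :: "vtl_gen \<Rightarrow> (nat \<times> nat \<Rightarrow> nat \<times> nat) \<Rightarrow> nat \<times> nat \<Rightarrow> nat \<times> nat" where
  "gen_act (GE i) f = cup i (Suc i) f"
| "gen_act (GV i) f = permute_top (transpose i (Suc i)) f"

fun gen_loops :: "vtl_gen \<Rightarrow> (nat \<times> nat \<Rightarrow> nat \<times> nat) \<Rightarrow> nat" where
  "gen_loops (GE i) f = (if f (0, i) = (0, Suc i) then 1 else 0)"
| "gen_loops (GV i) f = 0"

text \<open>The last letter acts first, so each further letter is a left multiplication, the only
  kind computed so far.\<close>

fun word_matching :: "vtl_gen list \<Rightarrow> nat \<times> nat \<Rightarrow> nat \<times> nat" where
  "word_matching [] = id_matching"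
| "word_matching (g # w) = gen_act g (word_matching w)"

fun word_loops :: "vtl_gen list \<Rightarrow> nat" where
  "word_loops [] = 0"
| "word_loops (g # w) = gen_loops g (word_matching w) + word_loops w"

lemma vtl_gens_cases:
  assumes "g \<in> vtl_gens n"
  obtains i where "g = GE i" "1 \<le> i" "i < n" | i where "g = GV i" "1 \<le> i" "i < n"
  using assms by (fastforce simp: vtl_gens_def)

lemma gen_tangle_eq: "g \<in> vtl_gens n \<Longrightarrow> gen_tangle n g = tangle_of n (gen_act g id_matching)"
proof (erule vtl_gens_cases)
  fix i assume "g = GV i" "1 \<le> i" "i < n"
  then show ?thesis
    using permutation_tangle_eq[of n "transpose i (Suc i)"] transpose_points[of i n "Suc i"] v_tangle_eq
    by simp
qed (simp add: E_tangle_eq)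

lemma gen_concat:
  assumes "g \<in> vtl_gens n" and f: "matching n f"
  shows "matching n (gen_act g f)"
    and "tangle_concat (gen_tangle n g) (tangle_of n f) = tangle_of n (gen_act g f)"
    and "closed_curves (gen_tangle n g) (tangle_of n f) = gen_loops g f"
proof -
  have "matching n (gen_act g f) \<and> tangle_concat (gen_tangle n g) (tangle_of n f) = tangle_of n (gen_act g f)
      \<and> closed_curves (gen_tangle n g) (tangle_of n f) = gen_loops g f"
    using assms(1)
  proof (cases rule: vtl_gens_cases)
    case (1 i)
    then show ?thesis using matching_cup[OF f, of i "Suc i"] E_tangle_concat[OF f, of i] by simp
  next
    case (2 i)
    then show ?thesis
      using matching_permute_top[OF f, of "transpose i (Suc i)"] permutation_concat[OF f, of "transpose i (Suc i)"]
        transpose_points[of i n "Suc i"] v_tangle_eq[of i n] by simp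
  qed
  then show "matching n (gen_act g f)"
    and "tangle_concat (gen_tangle n g) (tangle_of n f) = tangle_of n (gen_act g f)"
    and "closed_curves (gen_tangle n g) (tangle_of n f) = gen_loops g f" by auto
qed

lemma matching_word: "w \<in> lists (vtl_gens n) \<Longrightarrow> matching n (word_matching w)"
  by (induction w) (auto simp: matching_id gen_concat(1))

text \<open>Induction on \<open>u\<close>: associativity exchanges gluing the first letter to
  \<open>u\<close> with gluing it to \<open>u @ v\<close>, and the cocycle identity balances the
  closed curves formed in the two orders.\<close>

lemma word_append:
  assumes "u \<in> lists (vtl_gens n)" "v \<in> lists (vtl_gens n)"
  shows "tangle_of n (word_matching (u @ v)) =
           tangle_concat (tangle_of n (word_matching u)) (tangle_of n (word_matching v))"
    and "word_loops (u @ v) = word_loops u + word_loops v +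
           closed_curves (tangle_of n (word_matching u)) (tangle_of n (word_matching v))"
proof -
  let ?t = "\<lambda>w. tangle_of n (word_matching w)"
  have "?t (u @ v) = tangle_concat (?t u) (?t v) \<and>
      word_loops (u @ v) = word_loops u + word_loops v + closed_curves (?t u) (?t v)"
    using assms(1)
  proof (induction u)
    case Nil
    \<comment> \<open>The empty word gives the permutation tangle of \<open>id\<close>, for which
      gluing changes nothing and closes no curve.\<close>
    have "?t [] = permutation_tangle n id" using permutation_tangle_eq[of n id] by (simp add: permute_top_id)
    then show ?case using permutation_concat[OF matching_word[OF assms(2)], of id] by (simp add: permute_top_id)
  next
    case (Cons g u)
    then have g: "g \<in> vtl_gens n" and u: "u \<in> lists (vtl_gens n)" by auto
    then have uv: "u @ v \<in> lists (vtl_gens n)" using assms(2) by auto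
    let ?g = "gen_tangle n g"
    note mu = matching_word[OF u] and mv = matching_word[OF assms(2)] and muv = matching_word[OF uv]
    have mg: "matching n (gen_act g id_matching)" by (rule gen_concat(1)[OF g matching_id])
    have fin: "finite (\<Union>(tangle_of n f))" if "matching n f" for f
      using Union_tangle_of[OF that] finite_tangle_points by simp
    note assoc = tangle_concat_assoc[OF two_layered_tangle_of[OF mg] two_layered_tangle_of[OF mu]
        two_layered_tangle_of[OF mv] fin[OF mg] fin[OF mu] fin[OF mv], folded gen_tangle_eq[OF g]]
    have gu: "tangle_concat ?g (?t u) = ?t (g # u)" "closed_curves ?g (?t u) = gen_loops g (word_matching u)"
      using gen_concat(2,3)[OF g mu] by simp_all
    have guv: "tangle_concat ?g (?t (u @ v)) = ?t (g # u @ v)"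
      "closed_curves ?g (?t (u @ v)) = gen_loops g (word_matching (u @ v))"
      using gen_concat(2,3)[OF g muv] by simp_all
    have IH: "tangle_concat (?t u) (?t v) = ?t (u @ v)"
      "word_loops (u @ v) = word_loops u + word_loops v + closed_curves (?t u) (?t v)"
      using Cons.IH by simp_all
    show ?case
      using assoc[unfolded IH(1) gu guv] IH(2) by simp
  qed
  then show "?t (u @ v) = tangle_concat (?t u) (?t v)"
    "word_loops (u @ v) = word_loops u + word_loops v + closed_curves (?t u) (?t v)" by auto
qed

section \<open>The homomorphism on the free algebra\<close>

definition Phi :: "nat \<Rightarrow> (vtl_gen list \<Rightarrow>\<^sub>0 int poly) \<Rightarrow> (tangle \<Rightarrow>\<^sub>0 int poly)" where
  "Phi n = extend (\<lambda>w c. Poly_Mapping.single (tangle_of n (word_matching w)) (c * zvar ^ word_loops w))"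

lemma Phi_single [simp]:
  "Phi n (Poly_Mapping.single w c) =
     Poly_Mapping.single (tangle_of n (word_matching w)) (c * zvar ^ word_loops w)"
  by (simp add: Phi_def)

lemma Phi_add: "Phi n (x + y) = Phi n x + Phi n y"
  unfolding Phi_def by (rule extend_add) (simp_all add: distrib_right single_add)

lemma Phi_0 [simp]: "Phi n 0 = 0"
  by (simp add: Phi_def)

lemma Phi_scale: "Phi n (scale c x) = scale c (Phi n x)"
  using subset_UNIV[of "Poly_Mapping.keys x"]
  by (induction x rule: poly_mapping_keys_induct) (simp_all add: scale_simps Phi_add mult_ac)

lemma Phi_closed:
  assumes "Poly_Mapping.keys x \<subseteq> lists (vtl_gens n)"
  shows "Phi n x \<in> carrier (VTL n)"
  using assms unfolding VTL_def based_algebra_simps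
  by (induction x rule: poly_mapping_keys_induct)
    (simp_all add: Phi_add keys_add_sub tangle_of_flat[OF matching_word])

lemma VTL_mult_simps:
  "0 \<otimes>\<^bsub>VTL n\<^esub> y = 0" "x \<otimes>\<^bsub>VTL n\<^esub> 0 = 0"
  "(x + y) \<otimes>\<^bsub>VTL n\<^esub> z = x \<otimes>\<^bsub>VTL n\<^esub> z + y \<otimes>\<^bsub>VTL n\<^esub> z"
  "x \<otimes>\<^bsub>VTL n\<^esub> (y + z) = x \<otimes>\<^bsub>VTL n\<^esub> y + x \<otimes>\<^bsub>VTL n\<^esub> z"
  "Poly_Mapping.single u a \<otimes>\<^bsub>VTL n\<^esub> Poly_Mapping.single v b =
     Poly_Mapping.single (tangle_concat u v) (a * b * zvar ^ closed_curves u v)"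
  by (simp_all add: VTL_def based_algebra_mult_simps scale_simps)

lemma Phi_mult:
  assumes "Poly_Mapping.keys x \<subseteq> lists (vtl_gens n)" "Poly_Mapping.keys y \<subseteq> lists (vtl_gens n)"
  shows "Phi n (x \<otimes>\<^bsub>free_algebra (vtl_gens n)\<^esub> y) = Phi n x \<otimes>\<^bsub>VTL n\<^esub> Phi n y"
  using assms
  by (rule poly_mapping_biadditive_eqI)
    (simp_all add: free_algebra_mult_simps VTL_mult_simps Phi_add word_append power_add mult_ac)

lemma vtl_rels_closed:
  "vtl_rels n \<subseteq> carrier (free_algebra (vtl_gens n)) \<times> carrier (free_algebra (vtl_gens n))"
proof (rule subrelI)
  fix x y assume "(x, y) \<in> vtl_rels n"
  then show "(x, y) \<in> carrier (free_algebra (vtl_gens n)) \<times> carrier (free_algebra (vtl_gens n))"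
    by cases (auto simp: vtl_gens_def scale_simps)
qed

text \<open>Each relation becomes a comparison of two explicit involutions and of two loop counts.
  Only the square of a generator E closes a curve, and this curve supplies the factor z on the other
  side.\<close>

lemma Phi_rels:
  assumes "(x, y) \<in> vtl_rels n"
  shows "Phi n x = Phi n y"
proof -
  note f_simps = fun_eq_iff cup_def permute_top_def on_top_def id_matching_def transpose_def
  have pt: "tangle_of n f = tangle_of n g" if "\<And>a k. a = 0 \<or> a = 1 \<Longrightarrow> f (a, k) = g (a, k)" for f g
    by (rule tangle_of_cong) (use that in \<open>auto simp: tangle_points_def\<close>)
  have near: "i = Suc j \<or> j = Suc i" if "\<bar>int i - int j\<bar> = 1" for i j using that by linarith
  have far: "i \<noteq> j" "i \<noteq> Suc j" "j \<noteq> Suc i" if "\<bar>int i - int j\<bar> \<ge> 2" for i j using that by linarith+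
  show ?thesis
    using assms
  proof cases
    case (E_square i)
    have "tangle_of n (word_matching [GE i, GE i]) = tangle_of n (word_matching [GE i])" by (intro pt) (auto simp: f_simps)
    then show ?thesis using E_square by (simp add: scale_simps id_matching_def cup_def)
  next
    case (v_square i)
    have "tangle_of n (word_matching [GV i, GV i]) = tangle_of n (word_matching [])" by (intro pt) (auto simp: f_simps)
    then show ?thesis using v_square by simp
  next
    case (E_v i)
    have "tangle_of n (word_matching [GE i, GV i]) = tangle_of n (word_matching [GE i])" by (intro pt) (auto simp: f_simps)
    then show ?thesis using E_v by (simp add: id_matching_def permute_top_def)
  next
    case (v_E i)
    have "tangle_of n (word_matching [GV i, GE i]) = tangle_of n (word_matching [GE i])" by (intro pt) (auto simp: f_simps)
    then show ?thesis using v_E by simp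
  next
    case (E_E_far i j)
    have "tangle_of n (word_matching [GE i, GE j]) = tangle_of n (word_matching [GE j, GE i])"
      using far[OF E_E_far(5)] by (intro pt) (auto simp: f_simps)
    then show ?thesis using E_E_far far[OF E_E_far(5)] by (simp add: id_matching_def cup_def)
  next
    case (v_v_far i j)
    have "tangle_of n (word_matching [GV i, GV j]) = tangle_of n (word_matching [GV j, GV i])"
      using far[OF v_v_far(5)] by (intro pt) (auto simp: f_simps)
    then show ?thesis using v_v_far by simp
  next
    case (v_E_far i j)
    have "tangle_of n (word_matching [GV i, GE j]) = tangle_of n (word_matching [GE j, GV i])"
      using far[OF v_E_far(5)] by (intro pt) (auto simp: f_simps)
    then show ?thesis using v_E_far far[OF v_E_far(5)] by (simp add: id_matching_def permute_top_def)
  next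
    case (E_E_E i j)
    have "tangle_of n (word_matching [GE i, GE j, GE i]) = tangle_of n (word_matching [GE i])"
      using near[OF E_E_E(5)]
    proof
      assume [simp]: "i = Suc j"
      show ?thesis by (rule pt) (elim disjE; simp add: f_simps)
    next
      assume [simp]: "j = Suc i"
      show ?thesis by (rule pt) (elim disjE; simp add: f_simps)
    qed
    then show ?thesis using E_E_E near[OF E_E_E(5)] by (elim disjE; simp add: id_matching_def cup_def)
  next
    case (v_v_v i j)
    have "tangle_of n (word_matching [GV i, GV j, GV i]) = tangle_of n (word_matching [GV j, GV i, GV j])"
      using near[OF v_v_v(5)]
    proof
      assume [simp]: "i = Suc j"
      show ?thesis by (rule pt) (elim disjE; simp add: f_simps)
    next
      assume [simp]: "j = Suc i"
      show ?thesis by (rule pt) (elim disjE; simp add: f_simps)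
    qed
    then show ?thesis using v_v_v by simp
  next
    case (v_v_E i j)
    have "tangle_of n (word_matching [GV i, GV j, GE i]) = tangle_of n (word_matching [GE j, GV i, GV j])"
      using near[OF v_v_E(5)]
    proof
      assume [simp]: "i = Suc j"
      show ?thesis by (rule pt) (elim disjE; simp add: f_simps)
    next
      assume [simp]: "j = Suc i"
      show ?thesis by (rule pt) (elim disjE; simp add: f_simps)
    qed
    then show ?thesis using v_v_E near[OF v_v_E(5)] by (elim disjE; simp add: id_matching_def permute_top_def)
  qed
qed

section \<open>Surjectivity and failure of injectivity\<close>

text \<open>Words that close curves are excluded because they would yield only a multiple of the
  tangle by a power of z.\<close>

definition realizable :: "nat \<Rightarrow> (nat \<times> nat \<Rightarrow> nat \<times> nat) \<Rightarrow> bool" where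
  "realizable n f \<longleftrightarrow>
     (\<exists>w\<in>lists (vtl_gens n). (\<forall>p\<in>tangle_points n. word_matching w p = f p) \<and> word_loops w = 0)"

lemma realizable_cong:
  "realizable n f \<Longrightarrow> (\<And>p. p \<in> tangle_points n \<Longrightarrow> f p = g p) \<Longrightarrow> realizable n g"
  unfolding realizable_def by metis

lemma realizable_id: "realizable n id_matching"
  unfolding realizable_def by (rule bexI[of _ "[]"]) auto

lemma realizable_permute_adjacent:
  assumes "realizable n f" "1 \<le> i" "i < n"
  shows "realizable n (permute_top (transpose i (Suc i)) f)"
proof -
  obtain w where w: "w \<in> lists (vtl_gens n)" "\<And>p. p \<in> tangle_points n \<Longrightarrow> word_matching w p = f p"
    "word_loops w = 0" using assms(1) unfolding realizable_def by blast
  have "word_matching (GV i # w) p = permute_top (transpose i (Suc i)) f p" if p: "p \<in> tangle_points n" for p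
  proof -
    have "on_top (transpose i (Suc i)) p \<in> tangle_points n"
      using p assms by (intro on_top_points transpose_points) auto
    then show ?thesis by (simp add: permute_top_def w(2))
  qed
  moreover have "GV i # w \<in> lists (vtl_gens n)" using w(1) assms by (simp add: vtl_gens_def)
  ultimately show ?thesis unfolding realizable_def using w(3) by (intro bexI[of _ "GV i # w"]) simp_all
qed

text \<open>The last hypothesis says that the new letter E does not close a curve, so the loop count
  stays 0.\<close>

lemma realizable_cup_adjacent:
  assumes "realizable n f" "1 \<le> i" "i < n" "f (0, i) \<noteq> (0, Suc i)"
  shows "realizable n (cup i (Suc i) f)"
proof -
  obtain w where w: "w \<in> lists (vtl_gens n)" "\<And>p. p \<in> tangle_points n \<Longrightarrow> word_matching w p = f p"
    "word_loops w = 0" using assms(1) unfolding realizable_def by blast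
  have eq: "word_matching w (0, i) = f (0, i)" "word_matching w (0, Suc i) = f (0, Suc i)"
    using assms by (auto intro!: w(2))
  have "word_matching (GE i # w) p = cup i (Suc i) f p" if "p \<in> tangle_points n" for p
    using w(2)[OF that] by (simp add: cup_def eq)
  moreover have "word_loops (GE i # w) = 0" using w(3) eq assms(4) by simp
  moreover have "GE i # w \<in> lists (vtl_gens n)" using w(1) assms by (simp add: vtl_gens_def)
  ultimately show ?thesis unfolding realizable_def by blast
qed

lemma on_top_comp: "on_top (\<sigma> \<circ> \<tau>) = on_top \<sigma> \<circ> on_top \<tau>"
  by (auto simp: on_top_def fun_eq_iff)

text \<open>With \<open>s\<close> exchanging \<open>l\<close> and \<open>Suc l\<close>, the
  transposition of \<open>k\<close> and \<open>Suc l\<close> is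
  \<open>s \<circ> transpose k l \<circ> s\<close>; so induction on \<open>l\<close> leads back to
  adjacent transpositions.\<close>

lemma realizable_permute_less:
  assumes "realizable n f" "1 \<le> k" "k < l" "l \<le> n"
  shows "realizable n (permute_top (transpose k l) f)"
proof -
  have "Suc k \<le> l" using assms by simp
  then show ?thesis
    using assms(1,4)
  proof (induction l arbitrary: f rule: nat_induct_at_least)
    case base
    then show ?case using realizable_permute_adjacent assms(2) by simp
  next
    case (Suc l)
    let ?s = "transpose l (Suc l)"
    have "transpose k (Suc l) = ?s \<circ> transpose k l \<circ> ?s"
      using Suc.hyps by (auto simp: transpose_def fun_eq_iff)
    then have "permute_top (transpose k (Suc l)) f =
        permute_top ?s (permute_top (transpose k l) (permute_top ?s f))"
      by (simp add: permute_top_def on_top_comp comp_assoc)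
    moreover have "1 \<le> l" "l < n" "l \<le> n" using Suc by auto
    ultimately show ?case
      using Suc.IH Suc.prems(1) realizable_permute_adjacent by metis
  qed
qed

lemma realizable_permute:
  assumes "realizable n f" "k \<in> {1..n}" "l \<in> {1..n}" "k \<noteq> l"
  shows "realizable n (permute_top (transpose k l) f)"
  using assms realizable_permute_less[of n f k l] realizable_permute_less[of n f l k]
  by (cases "k < l") (auto simp: transpose_commute)

lemma permute_top_upd:
  assumes "\<And>k. \<sigma> (\<sigma> k) = k"
  shows "permute_top \<sigma> (f(a := b)) = (permute_top \<sigma> f)(on_top \<sigma> a := on_top \<sigma> b)"
proof
  fix p
  have "on_top \<sigma> p = a \<longleftrightarrow> p = on_top \<sigma> a" using on_top_involution[of \<sigma>, OF assms] by metis
  then show "permute_top \<sigma> (f(a := b)) p = ((permute_top \<sigma> f)(on_top \<sigma> a := on_top \<sigma> b)) p"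
    by (simp add: permute_top_def)
qed

lemma permute_top_involution:
  assumes "\<And>k. \<sigma> (\<sigma> k) = k"
  shows "permute_top \<sigma> (permute_top \<sigma> f) = f"
  by (rule ext) (simp add: permute_top_def on_top_involution[of \<sigma>, OF assms])

lemma permute_top_cup:
  assumes "\<And>k. \<sigma> (\<sigma> k) = k"
  shows "permute_top \<sigma> (cup k l f) = cup (\<sigma> k) (\<sigma> l) (permute_top \<sigma> f)"
  unfolding cup_def permute_top_upd[OF assms] by (simp add: permute_top_def assms)

lemma cup_commute:
  assumes "k \<noteq> l" "f (0, k) \<noteq> f (0, l)"
  shows "cup k l f = cup l k f"
  unfolding cup_def using assms by (auto simp: fun_eq_iff)

text \<open>Conjugation by the transposition of \<open>Suc k\<close> and \<open>l\<close> brings the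
  two top points next to each other. The adjacent case applies there, and the same transposition
  moves the result back.\<close>

lemma realizable_cup_less:
  assumes f: "realizable n f" and kl: "1 \<le> k" "k < l" "l \<le> n" "f (0, k) \<noteq> (0, l)"
  shows "realizable n (cup k l f)"
proof (cases "l = Suc k")
  case True
  then show ?thesis using realizable_cup_adjacent[OF f] kl by simp
next
  case False
  let ?s = "transpose (Suc k) l"
  have s: "?s (?s j) = j" for j by simp
  have less: "1 \<le> Suc k" "Suc k < l" using kl False by auto
  have "permute_top ?s f (0, k) \<noteq> (0, Suc k)"
  proof
    assume "permute_top ?s f (0, k) = (0, Suc k)"
    then have "on_top ?s (f (0, k)) = (0, Suc k)" using less by (simp add: permute_top_def)
    then have "f (0, k) = on_top ?s (0, Suc k)" using on_top_involution[of ?s, OF s] by metis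
    then show False using kl by simp
  qed
  then have "realizable n (cup k (Suc k) (permute_top ?s f))"
    using realizable_cup_adjacent[OF realizable_permute_less[OF f less kl(3)]] kl by simp
  from realizable_permute_less[OF this less kl(3)] show ?thesis
    using less unfolding permute_top_cup[of ?s, OF s] permute_top_involution[of ?s, OF s] by simp
qed

lemma matching_inj:
  "matching n f \<Longrightarrow> p \<in> tangle_points n \<Longrightarrow> q \<in> tangle_points n \<Longrightarrow> f p = f q \<Longrightarrow> p = q"
  using matchingD(3) by metis

lemma realizable_cup:
  assumes "realizable n f" "matching n f" "k \<in> {1..n}" "l \<in> {1..n}" "k \<noteq> l" "f (0, k) \<noteq> (0, l)"
  shows "realizable n (cup k l f)"
proof (cases "k < l")
  case True
  then show ?thesis using realizable_cup_less assms by simp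
next
  case False
  have pts: "(0, k) \<in> tangle_points n" "(0, l) \<in> tangle_points n" using assms by auto
  have "f (0, k) \<noteq> f (0, l)" using matching_inj[OF assms(2) pts] assms(5) by auto
  moreover have "f (0, l) \<noteq> (0, k)" using matchingD(3)[OF assms(2) pts(2)] assms(6) by metis
  ultimately show ?thesis
    using cup_commute[of k l f] realizable_cup_less[OF assms(1), of l k] False assms by simp
qed

text \<open>
  Each step turns one more strand into a vertical one: a slanted strand by permuting the top
  points, a cup by reconnecting it with a cap, which is undone by \<open>cup\<close>.
\<close>

lemma realizable_matching: "matching n f \<Longrightarrow> realizable n f"
proof (induction "card {k \<in> {1..n}. f (0, k) \<noteq> (1, k)}" arbitrary: f rule: less_induct)
  case (less f)
  note f = less.prems
  let ?bad = "\<lambda>f. {k \<in> {1..n}. f (0, k) \<noteq> (1, k)}"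
  \<comment> \<open>It suffices to make one new position vertical without disturbing the strands
    that are vertical already.\<close>
  have IH: "realizable n g" if "matching n g" "k \<in> ?bad f" "g (0, k) = (1, k)"
      "\<And>j. j \<in> {1..n} \<Longrightarrow> f (0, j) = (1, j) \<Longrightarrow> g (0, j) = (1, j)" for g k
  proof (rule less.hyps[OF _ that(1)])
    have "?bad g \<subset> ?bad f" using that(2-4) by blast
    then show "card (?bad g) < card (?bad f)" by (intro psubset_card_mono) simp_all
  qed
  show ?case
  proof (cases "\<exists>k l. k \<in> {1..n} \<and> f (0, k) = (1, l) \<and> l \<noteq> k")
    case True
    then obtain k l where kl: "k \<in> {1..n}" "f (0, k) = (1, l)" "l \<noteq> k" by blast
    have k: "(0, k) \<in> tangle_points n" using kl by auto
    have l: "l \<in> {1..n}" using matchingD(1)[OF f k] kl(2) by simp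
    then have l': "(0, l) \<in> tangle_points n" by simp
    have fl: "f (0, l) \<noteq> (1, l)" using matching_inj[OF f k l'] kl by auto
    let ?s = "transpose k l"
    have s: "?s (?s j) = j" for j by simp
    have sp: "?s j \<in> {1..n}" if "j \<in> {1..n}" for j using that kl(1) l by (intro transpose_points) auto
    \<comment> \<open>The partner of \<open>(0, k)\<close> sits below position \<open>l\<close>, so
      exchanging the top points \<open>k\<close> and \<open>l\<close> makes position
      \<open>l\<close> vertical.\<close>
    have "realizable n (permute_top ?s f)"
    proof (rule IH)
      show "matching n (permute_top ?s f)" by (rule matching_permute_top[OF f sp s])
      show "l \<in> ?bad f" using l fl by simp
      show "permute_top ?s f (0, l) = (1, l)" using kl by (simp add: permute_top_def)
      fix j assume j: "j \<in> {1..n}" "f (0, j) = (1, j)"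
      then have "j \<noteq> k" "j \<noteq> l" using kl fl by auto
      then show "permute_top ?s f (0, j) = (1, j)" using j by (simp add: permute_top_def)
    qed
    from realizable_permute[OF this kl(1) l kl(3)[symmetric]] show ?thesis
      by (simp add: permute_top_involution)
  next
    case False
    show ?thesis
    proof (cases "?bad f = {}")
      case True
      have "id_matching p = f p" if p: "p \<in> tangle_points n" for p
      proof -
        obtain a k where [simp]: "p = (a, k)" by force
        have fk: "f (0, k) = (1, k)" using True p by auto
        moreover have "f (1, k) = (0, k)" using matchingD(3)[OF f, of "(0, k)"] fk p by simp
        moreover have "a = 0 \<or> a = 1" using p by auto
        ultimately show ?thesis by (auto simp: id_matching_def)
      qed
      then show ?thesis using realizable_cong[OF realizable_id] by blast
    next
      case bad: False
      then obtain k where k: "k \<in> {1..n}" "f (0, k) \<noteq> (1, k)" by blast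
      have A: "(0, k) \<in> tangle_points n" and C: "(1, k) \<in> tangle_points n" using k by auto
      obtain a l where al: "f (0, k) = (a, l)" by force
      have "a \<le> 1" "l \<in> {1..n}" using matchingD(1)[OF f A] al by auto
      moreover have "a \<noteq> 1" using False k al by auto
      ultimately have l: "f (0, k) = (0, l)" "l \<in> {1..n}" using al by auto
      have lk: "l \<noteq> k" using matchingD(2)[OF f A] l by auto
      obtain b d where bd: "f (1, k) = (b, d)" by force
      have bd': "b \<le> 1" "d \<in> {1..n}" using matchingD(1)[OF f C] bd by auto
      \<comment> \<open>Without slanted strands, a strand from \<open>(1, k)\<close> to the top
        would have to be vertical, but \<open>(0, k)\<close> has another partner. So
        \<open>(1, k)\<close> lies on an arc between bottom points, as \<open>(0, k)\<close> lies on
        one between top points.\<close>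
      have "b \<noteq> 0"
      proof
        assume "b = 0"
        then have "f (0, d) = (1, k)" using matchingD(3)[OF f C] bd by simp
        then show False using False k bd'(2) by metis
      qed
      then have d: "f (1, k) = (1, d)" "d \<in> {1..n}" using bd bd' by auto
      have dk: "d \<noteq> k" using matchingD(2)[OF f C] d by auto
      have fl: "f (0, l) = (0, k)" using matchingD(3)[OF f A] l by simp
      have fd: "f (1, d) = (1, k)" using matchingD(3)[OF f C] d by simp
      \<comment> \<open>The two horizontal arcs at position \<open>k\<close> are replaced by a
        vertical strand at \<open>k\<close> and a strand from \<open>(0, l)\<close> to
        \<open>(1, d)\<close>. Then \<open>cup k l\<close> joins the top ends and the bottom ends of
        these strands, restoring \<open>f\<close> without closing a curve.\<close>
      define g where "g = f((0, k) := (1, k), (1, k) := (0, k), (0, l) := (1, d), (1, d) := (0, l))"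
      have g4: "g (0, k) = (1, k)" "g (1, k) = (0, k)" "g (0, l) = (1, d)" "g (1, d) = (0, l)"
        using lk dk by (auto simp: g_def)
      have g: "g p = f p" if "p \<notin> {(0, k), (1, k), (0, l), (1, d)}" for p
        using that by (auto simp: g_def)
      have mg: "matching n g"
        unfolding matching_def
      proof
        fix p assume p: "p \<in> tangle_points n"
        show "g p \<in> tangle_points n \<and> g p \<noteq> p \<and> g (g p) = p"
        proof (cases "p \<in> {(0, k), (1, k), (0, l), (1, d)}")
          case True
          then show ?thesis using g4 k l(2) d(2) by auto
        next
          case np: False
          have "f p \<notin> {(0, k), (1, k), (0, l), (1, d)}"
          proof
            assume "f p \<in> {(0, k), (1, k), (0, l), (1, d)}"
            then have "f (f p) \<in> {(0, k), (1, k), (0, l), (1, d)}" using fl fd l(1) d(1) by auto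
            then show False using np matchingD(3)[OF f p] by simp
          qed
          then show ?thesis using g np matchingD[OF f p] by simp
        qed
      qed
      have "realizable n g"
      proof (rule IH[OF mg _ g4(1)])
        show "k \<in> ?bad f" using k by simp
        fix j assume j: "j \<in> {1..n}" "f (0, j) = (1, j)"
        then have "j \<noteq> k" "j \<noteq> l" using l fl by auto
        then show "g (0, j) = (1, j)" using g j by simp
      qed
      then have "realizable n (cup k l g)"
        using realizable_cup[OF _ mg k(1) l(2) lk[symmetric]] g4(1) by simp
      moreover have "cup k l g = f"
        unfolding cup_def g4 unfolding g_def using l(1) d(1) fl fd lk dk by (auto simp: fun_eq_iff)
      ultimately show ?thesis by simp
    qed
  qed
qed

lemma Phi_surj:
  assumes "y \<in> carrier (VTL n)"
  shows "\<exists>x\<in>carrier (free_algebra (vtl_gens n)). Phi n x = y"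
proof -
  have "Poly_Mapping.keys y \<subseteq> flat_tangles n" using assms by (simp add: VTL_def)
  then show ?thesis
  proof (induction y rule: poly_mapping_keys_induct)
    case zero
    then show ?case by (intro bexI[of _ 0]) simp_all
  next
    case (single E c)
    obtain f where f: "matching n f" "E = tangle_of n f" using flat_tangle_is_matching[OF single] .
    obtain w where w: "w \<in> lists (vtl_gens n)" "\<And>p. p \<in> tangle_points n \<Longrightarrow> word_matching w p = f p"
      "word_loops w = 0" using realizable_matching[OF f(1)] unfolding realizable_def by blast
    have "E = tangle_of n (word_matching w)" unfolding f(2) by (rule tangle_of_cong) (simp add: w(2))
    then show ?case using w by (intro bexI[of _ "Poly_Mapping.single w c"]) simp_all
  next
    case (add x y)
    then obtain x' y' where "x' \<in> carrier (free_algebra (vtl_gens n))" "y' \<in> carrier (free_algebra (vtl_gens n))"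
      "Phi n x' = x" "Phi n y' = y" by blast
    then show ?case by (intro bexI[of _ "x' + y'"]) (simp_all add: Phi_add keys_add_sub)
  qed
qed

text \<open>The values are forced. Let all generators act as integers, with some E acting as a
  nonzero e. Then \<open>E\<^sub>i E\<^sub>j E\<^sub>i = E\<^sub>i\<close> and the mixed relation
  give every E the same value e = 1 or e = -1, the square relation gives z = e, and absorption gives
  v = 1. The identity \<open>E\<^sub>1 v\<^sub>2 E\<^sub>1 = E\<^sub>1\<close> would read e * e = e,
  so only e = -1 violates it.\<close>

fun gen_sign :: "vtl_gen \<Rightarrow> int" where
  "gen_sign (GE i) = -1"
| "gen_sign (GV i) = 1"

definition sign_rep :: "(vtl_gen list \<Rightarrow>\<^sub>0 int poly) \<Rightarrow> int" where
  "sign_rep = extend (\<lambda>w c. poly c (-1) * prod_list (map gen_sign w))"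

lemma sign_rep_single [simp]:
  "sign_rep (Poly_Mapping.single w c) = poly c (-1) * prod_list (map gen_sign w)"
  by (simp add: sign_rep_def)

lemma sign_rep_add: "sign_rep (x + y) = sign_rep x + sign_rep y"
  unfolding sign_rep_def by (rule extend_add) (simp_all add: distrib_right)

lemma sign_rep_mult: "sign_rep (x \<otimes>\<^bsub>free_algebra X\<^esub> y) = sign_rep x * sign_rep y"
  by (rule poly_mapping_biadditive_eqI[OF subset_UNIV subset_UNIV])
    (simp_all add: free_algebra_mult_simps sign_rep_add algebra_simps)

lemma sign_rep_rels: "(x, y) \<in> vtl_rels n \<Longrightarrow> sign_rep x = sign_rep y"
  by (erule vtl_rels.cases) (simp_all add: scale_simps zvar_def)

section \<open>The homomorphism on the presented algebra\<close>

lemma is_vtl_phi_eq_Phi: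
  assumes "is_vtl_phi n \<phi>" "x \<in> carrier (free_algebra (vtl_gens n))"
  shows "\<phi> (relation_ideal (vtl_gens n) (vtl_rels n) +>\<^bsub>free_algebra (vtl_gens n)\<^esub> x) = Phi n x"
proof (rule hom_determined[OF vtl_rels_closed, where A = "VTL n"])
  show "\<phi> \<in> alg_hom (presented_algebra (vtl_gens n) (vtl_rels n)) (VTL n)"
    using assms(1) by (simp add: is_vtl_phi_def VTL'_def)
  show "\<phi> (presented_gen (vtl_gens n) (vtl_rels n) g) = Phi n (word [g])" if g: "g \<in> vtl_gens n" for g
    using g
  proof (cases rule: vtl_gens_cases)
    case (1 i)
    then show ?thesis
      using assms(1) gen_tangle_eq[OF g] by (simp add: is_vtl_phi_def E'_def id_matching_def)
  next
    case (2 i)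
    then show ?thesis
      using assms(1) gen_tangle_eq[OF g] by (simp add: is_vtl_phi_def v'_def)
  qed
qed (use assms(2) in \<open>simp_all add: Phi_add Phi_mult Phi_scale, simp_all add: VTL_def based_algebra_def id_tangle_eq\<close>)

lemma vtl_phi_exists:
  obtains \<phi> where "\<phi> \<in> extensional (carrier (VTL' n))" "is_vtl_phi n \<phi>"
proof -
  have simps: "add (VTL n) = (+)" "\<one>\<^bsub>VTL n\<^esub> = Poly_Mapping.single (id_tangle n) 1"
    "\<And>c x. c \<odot>\<^bsub>VTL n\<^esub> x = scale c x" by (simp_all add: VTL_def based_algebra_def)
  obtain \<phi> where \<phi>: "\<phi> \<in> alg_hom (VTL' n) (VTL n)" "\<phi> \<in> extensional (carrier (VTL' n))"
    and eq: "\<And>x. x \<in> carrier (free_algebra (vtl_gens n)) \<Longrightarrow>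
      \<phi> (relation_ideal (vtl_gens n) (vtl_rels n) +>\<^bsub>free_algebra (vtl_gens n)\<^esub> x) = Phi n x"
    by (rule induced_hom[OF vtl_rels_closed[of n], where A = "VTL n" and h = "Phi n"])
      (simp_all add: VTL'_def Phi_add Phi_mult Phi_scale Phi_closed Phi_rels VTL_mult_simps simps id_tangle_eq)
  have gen: "\<phi> (presented_gen (vtl_gens n) (vtl_rels n) g) = Poly_Mapping.single (gen_tangle n g) 1"
    if g: "g \<in> vtl_gens n" for g
  proof -
    \<comment> \<open>A single generator closes no curve, so its image has coefficient 1.\<close>
    have "gen_loops g id_matching = 0" by (cases g) (simp_all add: id_matching_def)
    then show ?thesis using eq[of "word [g]"] g gen_tangle_eq[OF g] by (simp add: presented_gen_def)
  qed
  have "is_vtl_phi n \<phi>"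
    unfolding is_vtl_phi_def
  proof (intro conjI ballI)
    fix i assume i: "i \<in> {1..n - 1}"
    show "\<phi> (E' n i) = Poly_Mapping.single (E_tangle n i) 1"
      using gen[of "GE i"] i by (simp add: E'_def vtl_gens_def)
    show "\<phi> (v' n i) = Poly_Mapping.single (v_tangle n i) 1"
      using gen[of "GV i"] i by (simp add: v'_def vtl_gens_def)
  qed (rule \<phi>)
  with \<phi>(2) show ?thesis by (rule that)
qed

theorem proposition2p3:
  fixes n :: nat
  assumes "n \<ge> 3"
  shows "(\<exists>!\<phi>. \<phi> \<in> extensional (carrier (VTL' n)) \<and> is_vtl_phi n \<phi>) \<and>
         (\<forall>\<phi>. is_vtl_phi n \<phi> \<longrightarrow>
            \<phi> ` carrier (VTL' n) = carrier (VTL n) \<and> \<not> inj_on \<phi> (carrier (VTL' n)))"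
proof (intro conjI allI impI)
  let ?F = "free_algebra (vtl_gens n) :: (int poly, vtl_gen list \<Rightarrow>\<^sub>0 int poly) module"
  let ?J = "relation_ideal (vtl_gens n) (vtl_rels n)"
  let ?cls = "\<lambda>x. ?J +>\<^bsub>?F\<^esub> x"
  have car: "carrier (VTL' n) = {?cls x | x. x \<in> carrier ?F}"
    unfolding VTL'_def by (rule presented_algebra_simps(1)[OF vtl_rels_closed])
  show "\<exists>!\<phi>. \<phi> \<in> extensional (carrier (VTL' n)) \<and> is_vtl_phi n \<phi>"
  proof (rule ex_ex1I)
    show "\<exists>\<phi>. \<phi> \<in> extensional (carrier (VTL' n)) \<and> is_vtl_phi n \<phi>"
      using vtl_phi_exists by blast
    fix \<phi> \<psi> assume a: "\<phi> \<in> extensional (carrier (VTL' n)) \<and> is_vtl_phi n \<phi>"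
      "\<psi> \<in> extensional (carrier (VTL' n)) \<and> is_vtl_phi n \<psi>"
    show "\<phi> = \<psi>"
    proof (rule extensionalityI[of _ "carrier (VTL' n)"])
      fix C assume "C \<in> carrier (VTL' n)"
      then obtain x where "x \<in> carrier ?F" "C = ?cls x" unfolding car by blast
      then show "\<phi> C = \<psi> C" using a is_vtl_phi_eq_Phi by metis
    qed (use a in auto)
  qed
  fix \<phi> assume phi: "is_vtl_phi n \<phi>"
  show "\<phi> ` carrier (VTL' n) = carrier (VTL n)"
  proof (intro equalityI subsetI)
    fix y assume "y \<in> \<phi> ` carrier (VTL' n)"
    then obtain x where "x \<in> carrier ?F" "y = \<phi> (?cls x)" unfolding car by blast
    then show "y \<in> carrier (VTL n)" using is_vtl_phi_eq_Phi[OF phi] Phi_closed by simp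
  next
    fix y assume "y \<in> carrier (VTL n)"
    then obtain x where x: "x \<in> carrier ?F" "Phi n x = y" using Phi_surj by blast
    then have "y = \<phi> (?cls x)" using is_vtl_phi_eq_Phi[OF phi] by simp
    then show "y \<in> \<phi> ` carrier (VTL' n)" unfolding car using x(1) by blast
  qed
  show "\<not> inj_on \<phi> (carrier (VTL' n))"
  proof
    assume inj: "inj_on \<phi> (carrier (VTL' n))"
    \<comment> \<open>The bound \<open>n \<ge> 3\<close> makes \<open>GV 2\<close> a
      generator.\<close>
    let ?x = "word [GE 1, GV 2, GE 1] :: vtl_gen list \<Rightarrow>\<^sub>0 int poly" and ?y = "word [GE 1]"
    have xy: "?x \<in> carrier ?F" "?y \<in> carrier ?F" using assms by (auto simp: vtl_gens_def)
    \<comment> \<open>The strand at position 3 passes through both turn-backs next to the crossing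
      and leaves at position 3 again. It uses up all middle arcs at positions 1 to 3, so no closed
      curve remains.\<close>
    have "tangle_of n (word_matching [GE 1, GV 2, GE 1]) = tangle_of n (word_matching [GE 1])"
    proof (rule tangle_of_cong)
      fix p assume "p \<in> tangle_points n"
      then obtain a k where "p = (a, k)" "a = 0 \<or> a = 1" unfolding tangle_points_def by blast
      then show "word_matching [GE 1, GV 2, GE 1] p = word_matching [GE 1] p"
        by (elim disjE) (simp_all add: cup_def permute_top_def on_top_def id_matching_def transpose_def)
    qed
    moreover have "word_loops [GE 1, GV 2, GE 1] = 0"
      by (simp add: cup_def permute_top_def on_top_def id_matching_def transpose_def)
    ultimately have "Phi n ?x = Phi n ?y" by (simp only: Phi_single) (simp add: id_matching_def)
    then have "\<phi> (?cls ?x) = \<phi> (?cls ?y)" using is_vtl_phi_eq_Phi[OF phi] xy by metis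
    moreover have "?cls ?x \<in> carrier (VTL' n)" "?cls ?y \<in> carrier (VTL' n)" unfolding car using xy by blast+
    ultimately have "?cls ?x = ?cls ?y" using inj by (simp add: inj_on_eq_iff)
    moreover have "?x \<in> ?cls ?x" using mem_cls[OF vtl_rels_closed] additive_subgroup.zero_closed[OF ideal.axioms(1)[OF ideal_relation_ideal[OF vtl_rels_closed]]] by simp
    ultimately have "?x - ?y \<in> ?J" using mem_cls[OF vtl_rels_closed] by metis
    \<comment> \<open>\<open>sign_rep\<close> vanishes on the ideal, yet it is 1 at
      \<open>?x\<close> and -1 at \<open>?y\<close>.\<close>
    then have "sign_rep (?x - ?y) = 0"
      using relation_ideal_kernel[OF vtl_rels_closed[of n], of sign_rep "(*)"] sign_rep_add sign_rep_mult sign_rep_rels by simp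
    moreover have "sign_rep ?x = sign_rep (?x - ?y) + sign_rep ?y" using sign_rep_add[of "?x - ?y" ?y] by simp
    ultimately show False by simp
  qed
qed

end
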